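(* Let $k,n$ be integers with $1\le k\le n$. (a) Let $M$ be a Hermitian matrix of order $n$. Let $A$ be a principal submatrix of $M$ chosen uniformly at random from the set of all $k\times k$ principal submatrices of $M$. Let $F_A$ be the empirical spectral distribution function of $A$ and let $F$ be the expected spectral distribution function of $A$, that is, $F(x)=\mathbb{E}\,F_A(x)$ for $x\in\mathbb{R}$. Then for each real $r\ge 0$, $$\mathbb{P}\left(\|F_A-F\|_\infty\ge k^{-1/2}+r\right)\le 12\sqrt{k}\,e^{-r\sqrt{k/8}},$$ and consequently $$\mathbb{E}\,\|F_A-F\|_\infty\le \frac{13+\sqrt{8}\,\log k}{\sqrt{k}}.$$ (b) Let $M$ be an arbitrary (not necessarily Hermitian) complex $n\times n$ matrix. Let $A$ be a $k\times n$ submatrix of $M$ chosen uniformly at random, let $F_A$ be the empirical distribution function of the singular values of $A$, and let $F(x)=\mathbb{E}\,F_A(x)$ for $x\in\mathbb{R}$. Then the same two bounds hold: for each real $r\ge 0$, $$\mathbb{P}\left(\|F_A-F\|_\infty\ge k^{-1/2}+r\right)\le 12\sqrt{k}\,e^{-r\sqrt{k/8}},$$ and $$\mathbb{E}\,\|F_A-F\|_\infty\le \frac{13+\sqrt{8}\,\log k}{\sqrt{k}}.$$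
   Context: For a square matrix $M$ of order $n$ and index sets $\{i_1,\ldots,i_k\},\{j_1,\ldots,j_l\}\subseteq\{1,\ldots,n\}$, $M(i_1,\ldots,i_k;j_1,\ldots,j_l)$ denotes the $k\times l$ submatrix of $M$ formed by deleting all rows except rows $i_1,\ldots,i_k$ and all columns except columns $j_1,\ldots,j_l$. A $k\times k$ principal submatrix is one of the form $M(i_1,\ldots,i_k;i_1,\ldots,i_k)$; choosing one uniformly at random means choosing the $k$-element index set $\{i_1,\ldots,i_k\}\subseteq\{1,\ldots,n\}$ uniformly among all $\binom{n}{k}$ such sets. A $k\times n$ submatrix is one of the form $M(i_1,\ldots,i_k;1,\ldots,n)$ (that is, $k$ rows are kept, with all columns); choosing one uniformly at random means choosing the $k$-element set of rows uniformly among all $\binom{n}{k}$ such sets. For a Hermitian matrix $A$ of order $k$ with eigenvalues $\lambda_1,\ldots,\lambda_k$ (repeated according to multiplicity), its empirical spectral distribution function is $F_A(x)=\#\{i:\lambda_i\le x\}/k$, $x\in\mathbb{R}$. For a $k\times n$ matrix $A$ with $k\le n$, the singular values are the $k$ nonnegative square roots $s_1,\ldots,s_k$ of the eigenvalues of the $k\times k$ matrix $AA^*$ (repeated according to multiplicity), and the empirical distribution function of the singular values is $F_A(x)=\#\{i:s_i\le x\}/k$, $x\in\mathbb{R}$. For a bounded function $G:\mathbb{R}\to\mathbb{R}$, $\|G\|_\infty=\sup_{x\in\mathbb{R}}|G(x)|$. The symbol $\log$ denotes the natural logarithm. $\mathbb{P}$ and $\mathbb{E}$ refer to the random choice of $A$;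 the matrix $M$ is deterministic. *)

theory Defs
  imports
    "HOL-Probability.Probability_Mass_Function"
    "Jordan_Normal_Form.Char_Poly"
    "Jordan_Normal_Form.Schur_Decomposition"
    "Jordan_Normal_Form.DL_Submatrix"
begin

definition hermitian :: "complex mat \<Rightarrow> bool" where
  "hermitian A \<longleftrightarrow> square_mat A \<and> mat_adjoint A = A"

definition eigenvalues_mset :: "complex mat \<Rightarrow> complex multiset" where
  "eigenvalues_mset A = proots (char_poly A)"

(* Only meant for Hermitian A: its eigenvalues are real, so Re merely changes the type. *)
definition spectral_distr :: "complex mat \<Rightarrow> real \<Rightarrow> real" where
  "spectral_distr A x =
     real (size {# l \<in># image_mset Re (eigenvalues_mset A). l \<le> x #}) / real (dim_row A)"

(* A has at most as many rows as columns. The eigenvalues of A A^* are real and nonnegative,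
   so here, too, Re merely changes the type. *)
definition singular_values_mset :: "complex mat \<Rightarrow> real multiset" where
  "singular_values_mset A =
     image_mset (\<lambda>l. sqrt (Re l)) (eigenvalues_mset (A * mat_adjoint A))"

definition singular_distr :: "complex mat \<Rightarrow> real \<Rightarrow> real" where
  "singular_distr A x =
     real (size {# s \<in># singular_values_mset A. s \<le> x #}) / real (dim_row A)"

(* Rows and columns are numbered from 0. *)
definition index_sets :: "nat \<Rightarrow> nat \<Rightarrow> nat set set" where
  "index_sets n k = {I. I \<subseteq> {..<n} \<and> card I = k}"

definition random_principal_submatrix :: "nat \<Rightarrow> complex mat \<Rightarrow> complex mat pmf" where
  "random_principal_submatrix k M =
     map_pmf (\<lambda>I. submatrix M I I) (pmf_of_set (index_sets (dim_row M) k))"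

definition random_row_submatrix :: "nat \<Rightarrow> complex mat \<Rightarrow> complex mat pmf" where
  "random_row_submatrix k M =
     map_pmf (\<lambda>I. submatrix M I {..<dim_col M}) (pmf_of_set (index_sets (dim_row M) k))"

definition expected_distr :: "'a pmf \<Rightarrow> ('a \<Rightarrow> real \<Rightarrow> real) \<Rightarrow> real \<Rightarrow> real" where
  "expected_distr p F x = measure_pmf.expectation p (\<lambda>A. F A x)"

(* Only meant for bounded G; the supremum is that of the reals. *)
definition sup_norm :: "(real \<Rightarrow> real) \<Rightarrow> real" where
  "sup_norm G = (SUP x. \<bar>G x\<bar>)"

end

theory Submission
  imports Defs "HOL-Probability.Hoeffding"
begin

text \<open>Replacing one index of a principal submatrix changes its number of eigenvalues at most \<open>x\<close> by at
  most one (Cauchy interlacing), so \<open>F\<^sub>A(x)\<close> is a function of the random index set that changes by at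
  most \<open>1/k\<close> when one index is swapped. Hoeffding's lemma, applied to the increments of the martingale
  that reveals the indices one by one, bounds the exponential moments of \<open>F\<^sub>A(x) - F(x)\<close>. Cutting the
  real line into about \<open>\<surd>k\<close> pieces on which \<open>F\<close> varies by at most \<open>1/\<surd>k\<close> turns this into the single bound
  \<open>E exp (\<surd>k \<parallel>F\<^sub>A - F\<parallel>) \<le> 12 e \<surd>k\<close>, from which the tail bound follows by Markov's inequality and the
  expectation bound by convexity of the exponential. For a row submatrix \<open>A\<close> of \<open>M\<close>, the matrix \<open>A A\<^sup>*\<close>
  is a principal submatrix of the Hermitian matrix \<open>M M\<^sup>*\<close>, which reduces singular values to
  eigenvalues.\<close>

subsection \<open>Hermitian matrices and interlacing\<close>

lemma mat_adjoint_complex: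
  "mat_adjoint (A :: complex mat) = mat (dim_col A) (dim_row A) (\<lambda>(i, j). cnj (A $$ (j, i)))"
  by (rule eq_matI) (auto simp: mat_adjoint_def mat_of_rows_def conjugate_complex_def)

lemma mat_adjoint_carrier:
  "(A :: complex mat) \<in> carrier_mat n m \<Longrightarrow> mat_adjoint A \<in> carrier_mat m n"
  by (auto simp: mat_adjoint_complex)

lemma mat_adjoint_adjoint [simp]: "mat_adjoint (mat_adjoint (A :: complex mat)) = A"
  by (rule eq_matI) (auto simp: mat_adjoint_complex)

lemma mat_adjoint_mult:
  fixes A B :: "complex mat"
  assumes "A \<in> carrier_mat n m" "B \<in> carrier_mat m k"
  shows "mat_adjoint (A * B) = mat_adjoint B * mat_adjoint A"
  using assms by (intro eq_matI) (auto simp: mat_adjoint_complex scalar_prod_def mult.commute)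

section \<open>The spectral theorem for Hermitian matrices\<close>

text \<open>Gram-Schmidt applied to a basis starting with \<open>v\<close> keeps \<open>v\<close> in
  front and yields orthogonal, not yet normalized, vectors. Dividing them by their norms gives the
  matrix used below to split off an eigenvector.\<close>

lemma unitary_first_column:
  fixes v :: "complex vec"
  assumes v: "v \<in> carrier_vec n" and v0: "v \<noteq> 0\<^sub>v n"
  obtains W c where "W \<in> carrier_mat n n" "mat_adjoint W * W = 1\<^sub>m n" "col W 0 = c \<cdot>\<^sub>v v"
proof -
  interpret cof_vec_space n "TYPE(complex)" .
  define b where "b = basis_completion v"
  define ws where "ws = gram_schmidt n b"
  from basis_completion[OF v v0, folded b_def]
  have dist_b: "distinct b" and indep: "\<not> lin_dep (set b)" and b: "set b \<subseteq> carrier_vec n"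
    and hdb: "hd b = v" and len_b: "length b = n" by auto
  have n: "n > 0" using v v0 by (cases n) auto
  then obtain vs where bv: "b = v # vs" using hdb len_b by (cases b) auto
  from gram_schmidt_result[OF b dist_b indep refl, folded ws_def]
  have ws: "set ws \<subseteq> carrier_vec n" "corthogonal ws" "length ws = n" by (auto simp: len_b)
  have hdws: "ws ! 0 = v"
    using gram_schmidt_hd[OF v, of vs, folded bv ws_def] ws(3) n by (metis hd_conv_nth length_0_conv less_not_refl)
  have wsc: "ws ! i \<in> carrier_vec n" if "i < n" for i using ws that by auto
  define r where "r i = sqrt (\<Sum>l<n. (cmod (ws ! i $ l))\<^sup>2)" for i
  have ip: "(\<Sum>l<n. ws ! i $ l * cnj (ws ! j $ l)) = (if i = j then complex_of_real ((r i)\<^sup>2) else 0)"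
    if "i < n" "j < n" for i j
  proof (cases "i = j")
    case True
    have "(\<Sum>l<n. ws ! i $ l * cnj (ws ! i $ l)) = complex_of_real (\<Sum>l<n. (cmod (ws ! i $ l))\<^sup>2)"
      by (simp only: of_real_sum complex_norm_square)
    then show ?thesis using True by (simp add: r_def sum_nonneg)
  next
    case False
    have "ws ! i \<bullet>c ws ! j = 0" using corthogonalD[OF ws(2), of i j] that ws(3) False by simp
    then show ?thesis using False that wsc[of i] wsc[of j]
      by (simp add: scalar_prod_def conjugate_complex_def atLeast0LessThan)
  qed
  have r0: "r i \<noteq> 0" if "i < n" for i
  proof
    assume "r i = 0"
    then have "(\<Sum>l<n. ws ! i $ l * cnj (ws ! i $ l)) = 0" using ip[OF that that] by simp
    then have "ws ! i \<bullet>c ws ! i = 0" using that wsc[of i]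
      by (simp add: scalar_prod_def conjugate_complex_def atLeast0LessThan)
    then show False using corthogonalD[OF ws(2), of i i] that ws(3) by simp
  qed
  define W where "W = mat n n (\<lambda>(l, i). ws ! i $ l / complex_of_real (r i))"
  have W: "W \<in> carrier_mat n n" by (simp add: W_def)
  have "mat_adjoint W * W = 1\<^sub>m n"
  proof (rule eq_matI)
    fix i j assume "i < dim_row (1\<^sub>m n :: complex mat)" "j < dim_col (1\<^sub>m n :: complex mat)"
    then have ij: "i < n" "j < n" by auto
    have "(mat_adjoint W * W) $$ (i, j)
        = (\<Sum>l<n. cnj (ws ! i $ l) / complex_of_real (r i) * (ws ! j $ l / complex_of_real (r j)))"
      using ij by (simp add: W_def mat_adjoint_complex scalar_prod_def atLeast0LessThan)
    also have "\<dots> = (\<Sum>l<n. ws ! j $ l * cnj (ws ! i $ l)) / (complex_of_real (r i) * complex_of_real (r j))"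
      by (simp add: sum_divide_distrib mult.commute)
    also have "\<dots> = 1\<^sub>m n $$ (i, j)"
      using ij r0[of i] by (auto simp: ip power2_eq_square)
    finally show "(mat_adjoint W * W) $$ (i, j) = 1\<^sub>m n $$ (i, j)" .
  qed (use W in \<open>auto simp: mat_adjoint_complex\<close>)
  moreover have "col W 0 = (1 / complex_of_real (r 0)) \<cdot>\<^sub>v v"
    using n v by (intro eq_vecI) (auto simp: W_def hdws)
  ultimately show ?thesis using that W by blast
qed

text \<open>Deflation: conjugating by a unitary matrix whose first column is an eigenvector splits
  off a 1 by 1 block, because symmetry clears the first row along with the first column. The
  induction hypothesis diagonalizes the remaining block.\<close>

lemma hermitian_unitary_diagonalization:
  fixes A :: "complex mat"
  assumes "A \<in> carrier_mat n n" "mat_adjoint A = A"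
  shows "\<exists>U \<in> carrier_mat n n. mat_adjoint U * U = 1\<^sub>m n \<and> diagonal_mat (mat_adjoint U * A * U)"
  using assms
proof (induction n arbitrary: A)
  case 0
  then show ?case by (intro bexI[of _ "1\<^sub>m 0"]) (auto simp: diagonal_mat_def mat_adjoint_complex intro!: eq_matI)
next
  case (Suc m A)
  let ?n = "Suc m"
  note A = Suc.prems(1)
  obtain as where "char_poly A = (\<Prod>a\<leftarrow>as. [:- a, 1:])" "length as = ?n"
    using char_poly_factorized[OF A] by auto
  then obtain e where "poly (char_poly A) e = 0" by (cases as) auto
  then have "eigenvalue A e" using eigenvalue_root_char_poly[OF A] by simp
  then obtain v where v: "v \<in> carrier_vec ?n" "v \<noteq> 0\<^sub>v ?n" "A *\<^sub>v v = e \<cdot>\<^sub>v v"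
    using A unfolding eigenvalue_def eigenvector_def by auto
  obtain W c where W: "W \<in> carrier_mat ?n ?n" and WW: "mat_adjoint W * W = 1\<^sub>m ?n"
    and col: "col W 0 = c \<cdot>\<^sub>v v"
    using unitary_first_column[OF v(1,2)] by blast
  let ?W = "mat_adjoint W"
  have W': "?W \<in> carrier_mat ?n ?n" using W by (rule mat_adjoint_carrier)
  define B where "B = ?W * A * W"
  have B: "B \<in> carrier_mat ?n ?n" using W W' A by (simp add: B_def)
  have adjB: "mat_adjoint B = B"
    using W W' A Suc.prems(2)
    by (simp add: B_def mat_adjoint_mult[of _ ?n ?n _ ?n] assoc_mult_mat[of _ ?n ?n _ ?n _ ?n])
  have Bsym: "B $$ (i, j) = cnj (B $$ (j, i))" if "i < ?n" "j < ?n" for i j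
    using arg_cong[OF adjB, of "\<lambda>X. X $$ (i, j)"] that B by (simp add: mat_adjoint_complex)
  have colW: "col W 0 \<in> carrier_vec ?n" using W by (intro carrier_vecI) auto
  \<comment> \<open>\<open>W\<close> sends the first basis vector to an eigenvector,
    \<open>A\<close> scales it by \<open>e\<close>, and \<open>mat_adjoint W\<close> carries it
    back.\<close>
  have "col B 0 = ?W *\<^sub>v (A *\<^sub>v col W 0)"
  proof -
    have "B = ?W * (A * W)" using W W' A by (simp add: B_def)
    then show ?thesis
      using col_mult2[OF W' mult_carrier_mat[OF A W], of 0] col_mult2[OF A W, of 0] by simp
  qed
  also have "A *\<^sub>v col W 0 = e \<cdot>\<^sub>v col W 0"
    using A v by (simp add: col mult_mat_vec smult_smult_assoc mult.commute)
  also have "?W *\<^sub>v (e \<cdot>\<^sub>v col W 0) = e \<cdot>\<^sub>v (?W *\<^sub>v col W 0)"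
    by (rule mult_mat_vec[OF W' colW])
  also have "?W *\<^sub>v col W 0 = col (?W * W) 0"
    using col_mult2[OF W' W, of 0] by simp
  finally have colB: "col B 0 = e \<cdot>\<^sub>v unit_vec ?n 0" by (simp add: WW)
  have B0: "B $$ (i, 0) = 0" if "0 < i" "i < ?n" for i
    using arg_cong[OF colB, of "\<lambda>v. v $ i"] that B by simp
  define C where "C = mat m m (\<lambda>(i, j). B $$ (Suc i, Suc j))"
  have C: "C \<in> carrier_mat m m" by (simp add: C_def)
  have "mat_adjoint C = C"
    by (rule eq_matI) (auto simp: mat_adjoint_complex C_def Bsym[symmetric])
  from Suc.IH[OF C this] obtain V where V: "V \<in> carrier_mat m m" "mat_adjoint V * V = 1\<^sub>m m"
    and dV: "diagonal_mat (mat_adjoint V * C * V)" by auto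
  define b where "b = B $$ (0, 0)"
  let ?E = "mat 1 1 (\<lambda>_. b)"
  have blk: "B = four_block_mat ?E (0\<^sub>m 1 m) (0\<^sub>m m 1) C"
  proof (rule eq_matI)
    fix i j
    assume "i < dim_row (four_block_mat ?E (0\<^sub>m 1 m) (0\<^sub>m m 1) C)"
      "j < dim_col (four_block_mat ?E (0\<^sub>m 1 m) (0\<^sub>m m 1) C)"
    then have ij: "i < ?n" "j < ?n" using C by auto
    show "B $$ (i, j) = four_block_mat ?E (0\<^sub>m 1 m) (0\<^sub>m m 1) C $$ (i, j)"
      using ij B0[of i] B0[of j] Bsym[of i j] C by (cases i; cases j) (auto simp: C_def b_def)
  qed (use B C in auto)
  \<comment> \<open>\<open>X\<close> extends \<open>V\<close> by a 1 by 1 identity block, so that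
    \<open>W * X\<close> is the required unitary matrix.\<close>
  define X where "X = four_block_mat (1\<^sub>m 1) (0\<^sub>m 1 m) (0\<^sub>m m 1) V"
  have X: "X \<in> carrier_mat ?n ?n" using V by (auto simp: X_def)
  have adjX: "mat_adjoint X = four_block_mat (1\<^sub>m 1) (0\<^sub>m 1 m) (0\<^sub>m m 1) (mat_adjoint V)"
    using V by (intro eq_matI) (auto simp: X_def mat_adjoint_complex)
  have V': "mat_adjoint V \<in> carrier_mat m m" using V(1) by (rule mat_adjoint_carrier)
  have mult_blk: "four_block_mat P (0\<^sub>m 1 m) (0\<^sub>m m 1) S * four_block_mat P' (0\<^sub>m 1 m) (0\<^sub>m m 1) S'
      = four_block_mat (P * P') (0\<^sub>m 1 m) (0\<^sub>m m 1) (S * S')"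
    if "P \<in> carrier_mat 1 1" "P' \<in> carrier_mat 1 1" "S \<in> carrier_mat m m" "S' \<in> carrier_mat m m"
    for P P' S S' :: "complex mat"
    using that by (subst mult_four_block_mat[of _ 1 1 _ m _ m _ _ 1 _ m]) auto
  have XX: "mat_adjoint X * X = 1\<^sub>m ?n"
    unfolding adjX unfolding X_def
    by (simp only: mult_blk[OF one_carrier_mat one_carrier_mat V' V(1)]
        left_mult_one_mat[OF one_carrier_mat] V(2) four_block_one_mat plus_1_eq_Suc)
  have E: "?E \<in> carrier_mat 1 1" by simp
  have VC: "mat_adjoint V * C \<in> carrier_mat m m" by (rule mult_carrier_mat[OF V' C])
  have XBX: "mat_adjoint X * B * X = four_block_mat ?E (0\<^sub>m 1 m) (0\<^sub>m m 1) (mat_adjoint V * C * V)"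
    unfolding adjX unfolding X_def blk
    by (simp only: mult_blk[OF one_carrier_mat E V' C] mult_blk[OF E one_carrier_mat VC V(1)]
        left_mult_one_mat[OF E] right_mult_one_mat[OF E])
  have D: "mat_adjoint V * C * V \<in> carrier_mat m m" by (rule mult_carrier_mat[OF VC V(1)])
  have diag: "diagonal_mat (mat_adjoint X * B * X)"
    unfolding XBX using dV D by (auto simp: diagonal_mat_def)
  have U: "W * X \<in> carrier_mat ?n ?n" using W X by simp
  have adjU: "mat_adjoint (W * X) = mat_adjoint X * ?W" using W X by (rule mat_adjoint_mult)
  have X': "mat_adjoint X \<in> carrier_mat ?n ?n" using X by (rule mat_adjoint_carrier)
  have "mat_adjoint (W * X) * (W * X) = mat_adjoint X * (?W * W) * X"
    unfolding adjU using W X W' X' by (simp add: assoc_mult_mat[of _ ?n ?n _ ?n _ ?n])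
  then have 1: "mat_adjoint (W * X) * (W * X) = 1\<^sub>m ?n"
    by (simp only: WW right_mult_one_mat[OF X'] XX)
  have "mat_adjoint (W * X) * A * (W * X) = mat_adjoint X * B * X"
    unfolding adjU B_def using W X W' X' A by (simp add: assoc_mult_mat[of _ ?n ?n _ ?n _ ?n])
  with 1 diag U show ?case by (intro bexI[of _ "W * X"]) auto
qed

text \<open>Keeping \<open>x\<close> free packs two facts into one identity: the coefficient of
  \<open>x\<close> says that \<open>U\<close> has orthonormal rows, the remainder that
  \<open>A\<close> equals \<open>U D U\<^sup>*\<close>.\<close>

lemma hermitian_spectral_decomposition:
  fixes A :: "complex mat"
  assumes A: "A \<in> carrier_mat k k" and herm: "hermitian A"
  shows "\<exists>(d :: nat \<Rightarrow> real) U. eigenvalues_mset A = mset (map (\<lambda>l. complex_of_real (d l)) [0..<k]) \<and>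
    (\<forall>i<k. \<forall>j<k. \<forall>x. (\<Sum>l<k. U i l * complex_of_real (d l - x) * cnj (U j l))
       = A $$ (i, j) - (if i = j then complex_of_real x else 0))"
proof -
  have adjA: "mat_adjoint A = A" using herm by (simp add: hermitian_def)
  obtain U where U: "U \<in> carrier_mat k k" and UU: "mat_adjoint U * U = 1\<^sub>m k"
    and diag: "diagonal_mat (mat_adjoint U * A * U)"
    using hermitian_unitary_diagonalization[OF A adjA] by blast
  let ?U = "mat_adjoint U"
  have U': "?U \<in> carrier_mat k k" using U by (rule mat_adjoint_carrier)
  have UU': "U * ?U = 1\<^sub>m k" by (rule mat_mult_left_right_inverse[OF U' U UU])
  define D where "D = ?U * A * U"
  have D: "D \<in> carrier_mat k k" using U U' A by (simp add: D_def)
  have dD: "diagonal_mat D" using diag by (simp only: D_def)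
  have adjD: "mat_adjoint D = D"
    using U U' A adjA
    by (simp add: D_def mat_adjoint_mult[of _ k k _ k] assoc_mult_mat[of _ k k _ k _ k])
  define d where "d l = Re (D $$ (l, l))" for l
  \<comment> \<open>\<open>D\<close> is Hermitian as well as diagonal, so its diagonal entries are
    real.\<close>
  have Dij: "D $$ (i, j) = (if i = j then complex_of_real (d i) else 0)" if "i < k" "j < k" for i j
  proof (cases "i = j")
    case True
    have "D $$ (i, i) = cnj (D $$ (i, i))"
      using arg_cong[OF adjD, of "\<lambda>X. X $$ (i, i)"] that D by (simp add: mat_adjoint_complex)
    then show ?thesis using True by (simp add: d_def complex_eq_iff)
  next
    case False
    then show ?thesis using dD that D by (simp add: diagonal_mat_def)
  qed
  have "U * D * ?U = (U * ?U) * A * (U * ?U)"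
    using U U' A by (simp add: D_def assoc_mult_mat[of _ k k _ k _ k])
  then have AUD: "A = U * D * ?U" using A by (simp add: UU')
  have "similar_mat_wit A D U ?U"
    by (rule similar_mat_witI[of _ _ k]) (use UU UU' AUD A D U U' in auto)
  then have "char_poly A = char_poly D" by (intro char_poly_similar) (auto simp: similar_mat_def)
  also have "\<dots> = (\<Prod>a\<leftarrow>diag_mat D. [:- a, 1:])"
    using D Dij by (intro char_poly_upper_triangular[of _ k]) auto
  also have "diag_mat D = map (\<lambda>l. complex_of_real (d l)) [0..<k]"
    using D Dij by (auto simp: diag_mat_def)
  finally have cp: "char_poly A = (\<Prod>a\<leftarrow>map (\<lambda>l. complex_of_real (d l)) [0..<k]. [:- a, 1:])" .
  have proots: "proots (\<Prod>a\<leftarrow>xs. [:- a, 1:]) = mset xs" for xs :: "complex list"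
  proof (induction xs)
    case (Cons a xs)
    have "(\<Prod>a\<leftarrow>xs. [:- a, 1:]) \<noteq> 0" by (auto simp: prod_list_zero_iff)
    then have "proots ([:- a, 1:] * (\<Prod>a\<leftarrow>xs. [:- a, 1:])) = {#a#} + mset xs"
      using Cons by (subst proots_mult) (auto simp del: mult_pCons_left)
    then show ?case by (simp del: mult_pCons_left)
  qed simp
  have 1: "eigenvalues_mset A = mset (map (\<lambda>l. complex_of_real (d l)) [0..<k])"
    unfolding eigenvalues_mset_def cp by (rule proots)
  have 2: "(\<Sum>l<k. U $$ (i, l) * complex_of_real (d l - x) * cnj (U $$ (j, l)))
      = A $$ (i, j) - (if i = j then x else 0)" if ij: "i < k" "j < k" for i j x
  proof -
    have UD: "(U * D) $$ (i, l) = U $$ (i, l) * d l" if "l < k" for l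
      using U D ij that
      by (simp add: scalar_prod_def atLeast0LessThan Dij if_distrib[where f = "\<lambda>z. _ * z"] sum.delta cong: if_cong)
    have mulU: "(X * ?U) $$ (i, j) = (\<Sum>l<k. X $$ (i, l) * cnj (U $$ (j, l)))"
      if "X \<in> carrier_mat k k" for X
      using that U ij by (simp add: scalar_prod_def atLeast0LessThan mat_adjoint_complex)
    have "A $$ (i, j) = (\<Sum>l<k. U $$ (i, l) * d l * cnj (U $$ (j, l)))"
      unfolding AUD mulU[OF mult_carrier_mat[OF U D]] by (intro sum.cong) (simp_all add: UD)
    moreover have "(\<Sum>l<k. U $$ (i, l) * cnj (U $$ (j, l))) = (if i = j then 1 else 0)"
      using arg_cong[OF UU', of "\<lambda>X. X $$ (i, j)"] ij U
      by (simp add: scalar_prod_def atLeast0LessThan mat_adjoint_complex)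
    moreover have "(\<Sum>l<k. U $$ (i, l) * complex_of_real (d l - x) * cnj (U $$ (j, l)))
        = (\<Sum>l<k. U $$ (i, l) * d l * cnj (U $$ (j, l))) - x * (\<Sum>l<k. U $$ (i, l) * cnj (U $$ (j, l)))"
      unfolding sum_distrib_left by (subst sum_subtractf[symmetric], rule sum.cong) (auto simp: algebra_simps)
    ultimately show ?thesis by simp
  qed
  show ?thesis
    by (rule exI[of _ d], rule exI[of _ "\<lambda>i l. U $$ (i, l)"]) (use 1 2 in simp)
qed

section \<open>Indexing of principal submatrices\<close>

lemma pick_bij_betw:
  assumes "I \<in> index_sets n k"
  shows "bij_betw (pick I) {..<k} I"
proof -
  have I: "card I = k" "finite I" using assms by (auto simp: index_sets_def finite_subset)
  have "inj_on (pick I) {..<k}"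
    by (intro linorder_inj_onI) (use I pick_mono[of _ I] in force)+
  moreover have "pick I ` {..<k} \<subseteq> I" using I pick_in_set[of _ I] by auto
  ultimately show ?thesis
    using I by (simp add: bij_betw_def card_image card_subset_eq)
qed

lemma principal_submatrix_carrier:
  assumes "M \<in> carrier_mat n n" "I \<in> index_sets n k"
  shows "submatrix M I I \<in> carrier_mat k k"
proof -
  have "{i. i < n \<and> i \<in> I} = I" using assms(2) by (auto simp: index_sets_def)
  then show ?thesis using assms by (auto simp: submatrix_def index_sets_def)
qed

lemma principal_submatrix_index:
  assumes "M \<in> carrier_mat n n" "I \<in> index_sets n k" "i < k" "j < k"
  shows "submatrix M I I $$ (i, j) = M $$ (pick I i, pick I j)"
proof -
  have "{i. i < n \<and> i \<in> I} = I" using assms(2) by (auto simp: index_sets_def)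
  then show ?thesis using assms by (auto simp: submatrix_def index_sets_def)
qed

lemma pick_less:
  assumes "I \<in> index_sets n k" "i < k"
  shows "pick I i < n"
  using bij_betwE[OF pick_bij_betw[OF assms(1)]] assms by (auto simp: index_sets_def)

lemma hermitian_index:
  assumes "M \<in> carrier_mat n n" "hermitian M" "i < n" "j < n"
  shows "M $$ (i, j) = cnj (M $$ (j, i))"
proof -
  have "mat_adjoint M = M" using assms(2) by (simp add: hermitian_def)
  from arg_cong[OF this, of "\<lambda>X. X $$ (i, j)"] show ?thesis
    using assms by (simp add: mat_adjoint_complex)
qed

lemma hermitian_principal_submatrix:
  assumes "M \<in> carrier_mat n n" "hermitian M" "I \<in> index_sets n k"
  shows "hermitian (submatrix M I I)"
proof -
  have S: "submatrix M I I \<in> carrier_mat k k" by (rule principal_submatrix_carrier[OF assms(1,3)])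
  have "mat_adjoint (submatrix M I I) = submatrix M I I"
  proof (rule eq_matI)
    fix i j assume "i < dim_row (submatrix M I I)" "j < dim_col (submatrix M I I)"
    then have "i < k" "j < k" using S by auto
    then show "mat_adjoint (submatrix M I I) $$ (i, j) = submatrix M I I $$ (i, j)"
      using S assms by (simp add: mat_adjoint_complex principal_submatrix_index pick_less
          hermitian_index[of M n "pick I i" "pick I j"])
  qed (use S in \<open>auto simp: mat_adjoint_complex\<close>)
  then show ?thesis using S by (simp add: hermitian_def)
qed

text \<open>The functionals \<open>u l\<close> are the coordinates in an orthonormal eigenbasis of the submatrix;
  comparing two values of \<open>x\<close> shows that they separate the vectors supported in \<open>I\<close>.\<close>

definition eigen_coordinates ::
  "complex mat \<Rightarrow> nat \<Rightarrow> nat \<Rightarrow> nat set \<Rightarrow> (nat \<Rightarrow> real) \<Rightarrow> (nat \<Rightarrow> nat \<Rightarrow> complex) \<Rightarrow> bool" where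
  "eigen_coordinates M n k I d u \<longleftrightarrow>
     eigenvalues_mset (submatrix M I I) = mset (map (\<lambda>l. complex_of_real (d l)) [0..<k]) \<and>
     (\<forall>v x. (\<forall>a. a \<notin> I \<longrightarrow> v a = 0) \<longrightarrow>
       (\<Sum>a<n. \<Sum>b<n. cnj (v a) * M $$ (a, b) * v b) - complex_of_real (x * (\<Sum>a<n. (cmod (v a))\<^sup>2))
       = complex_of_real (\<Sum>l<k. (d l - x) * (cmod (\<Sum>a<n. u l a * v a))\<^sup>2))"

text \<open>The eigenbasis of the submatrix is transported to the ambient indices along
  \<open>pick I\<close>. For vectors supported in \<open>I\<close>, all sums over \<open>n\<close>
  collapse to sums over \<open>k\<close>.\<close>

lemma eigen_coordinates_exist:
  fixes M :: "complex mat"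
  assumes M: "M \<in> carrier_mat n n" "hermitian M" and I: "I \<in> index_sets n k"
  shows "\<exists>d u. eigen_coordinates M n k I d u"
proof -
  let ?p = "pick I"
  have bij: "bij_betw ?p {..<k} I" by (rule pick_bij_betw[OF I])
  have Isub: "I \<subseteq> {..<n}" using I by (auto simp: index_sets_def)
  obtain d U where
    "eigenvalues_mset (submatrix M I I) = mset (map (\<lambda>l. complex_of_real (d l)) [0..<k]) \<and>
    (\<forall>i<k. \<forall>j<k. \<forall>x. (\<Sum>l<k. U i l * complex_of_real (d l - x) * cnj (U j l))
       = submatrix M I I $$ (i, j) - (if i = j then complex_of_real x else 0))"
    by (insert hermitian_spectral_decomposition[OF principal_submatrix_carrier[OF M(1) I]
        hermitian_principal_submatrix[OF M I]], elim exE, rule that)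
  then have ev: "eigenvalues_mset (submatrix M I I) = mset (map (\<lambda>l. complex_of_real (d l)) [0..<k])"
    and U: "\<And>i j x. i < k \<Longrightarrow> j < k \<Longrightarrow>
      (\<Sum>l<k. U i l * complex_of_real (d l - x) * cnj (U j l))
        = submatrix M I I $$ (i, j) - (if i = j then complex_of_real x else 0)"
    by blast+
  \<comment> \<open>At most one \<open>i\<close> contributes, as \<open>pick I\<close> is injective;
    outside \<open>I\<close> the functional vanishes.\<close>
  define u where "u l a = (\<Sum>i<k. if ?p i = a then cnj (U i l) else 0)" for l a
  have restrict: "(\<Sum>a<n. f a) = (\<Sum>i<k. f (?p i))" if "\<And>a. a \<notin> I \<Longrightarrow> f a = 0" for f :: "nat \<Rightarrow> complex"
  proof -
    have "(\<Sum>a<n. f a) = (\<Sum>a\<in>I. f a)" using that Isub by (intro sum.mono_neutral_right) auto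
    then show ?thesis using sum.reindex_bij_betw[OF bij, of f] by simp
  qed
  have "(\<Sum>a<n. \<Sum>b<n. cnj (v a) * M $$ (a, b) * v b) - complex_of_real (x * (\<Sum>a<n. (cmod (v a))\<^sup>2))
       = complex_of_real (\<Sum>l<k. (d l - x) * (cmod (\<Sum>a<n. u l a * v a))\<^sup>2)"
    if v: "\<And>a. a \<notin> I \<Longrightarrow> v a = 0" for v x
  proof -
    have uv: "(\<Sum>a<n. u l a * v a) = (\<Sum>i<k. cnj (U i l) * v (?p i))" for l
    proof -
      have "(\<Sum>a<n. u l a * v a) = (\<Sum>i<k. \<Sum>a<n. if a = ?p i then cnj (U i l) * v a else 0)"
        unfolding u_def sum_distrib_right
        by (subst sum.swap, rule sum.cong[OF refl], rule sum.cong[OF refl]) simp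
      also have "\<dots> = (\<Sum>i<k. cnj (U i l) * v (?p i))"
        using pick_less[OF I] by (intro sum.cong) auto
      finally show ?thesis .
    qed
    let ?z = "\<lambda>l. \<Sum>i<k. cnj (U i l) * v (?p i)"
    have "complex_of_real (d l - x) * (?z l * cnj (?z l))
        = (\<Sum>i<k. \<Sum>j<k. cnj (v (?p i)) * (U i l * complex_of_real (d l - x) * cnj (U j l)) * v (?p j))" for l
    proof -
      have "complex_of_real (d l - x) * (?z l * cnj (?z l))
          = complex_of_real (d l - x) * ((\<Sum>i<k. U i l * cnj (v (?p i))) * ?z l)"
        by (simp add: mult.commute)
      also have "\<dots> = (\<Sum>i<k. \<Sum>j<k. complex_of_real (d l - x) * (U i l * cnj (v (?p i)) * (cnj (U j l) * v (?p j))))"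
        unfolding sum_product by (simp only: sum_distrib_left)
      also have "\<dots> = (\<Sum>i<k. \<Sum>j<k. cnj (v (?p i)) * (U i l * complex_of_real (d l - x) * cnj (U j l)) * v (?p j))"
        by (rule sum.cong[OF refl], rule sum.cong[OF refl]) (simp only: mult_ac)
      finally show ?thesis .
    qed
    then have "complex_of_real (\<Sum>l<k. (d l - x) * (cmod (\<Sum>a<n. u l a * v a))\<^sup>2)
        = (\<Sum>l<k. \<Sum>i<k. \<Sum>j<k. cnj (v (?p i)) * (U i l * complex_of_real (d l - x) * cnj (U j l)) * v (?p j))"
      by (simp only: of_real_sum of_real_mult complex_norm_square uv)
    also have "\<dots> = (\<Sum>i<k. \<Sum>j<k. \<Sum>l<k. cnj (v (?p i)) * (U i l * complex_of_real (d l - x) * cnj (U j l)) * v (?p j))"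
      by (subst sum.swap, rule sum.cong[OF refl], rule sum.swap)
    also have "\<dots> = (\<Sum>i<k. \<Sum>j<k. cnj (v (?p i)) * (M $$ (?p i, ?p j) - (if i = j then complex_of_real x else 0)) * v (?p j))"
      by (intro sum.cong refl, subst sum_distrib_right[symmetric], subst sum_distrib_left[symmetric])
         (simp only: U principal_submatrix_index[OF M(1) I] lessThan_iff)
    also have "\<dots> = (\<Sum>i<k. \<Sum>j<k. cnj (v (?p i)) * M $$ (?p i, ?p j) * v (?p j))
         - (\<Sum>i<k. \<Sum>j<k. if i = j then x * (v (?p j) * cnj (v (?p i))) else 0)"
      by (subst sum_subtractf[symmetric], rule sum.cong[OF refl], subst sum_subtractf[symmetric],
          rule sum.cong[OF refl]) (simp add: algebra_simps)
    also have "\<dots> = (\<Sum>i<k. \<Sum>j<k. cnj (v (?p i)) * M $$ (?p i, ?p j) * v (?p j))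
         - (\<Sum>i<k. x * (v (?p i) * cnj (v (?p i))))"
      by simp
    also have "(\<Sum>i<k. x * (v (?p i) * cnj (v (?p i)))) = (\<Sum>a<n. x * (v a * cnj (v a)))"
      by (rule restrict[symmetric]) (simp add: v)
    also have "(\<Sum>i<k. \<Sum>j<k. cnj (v (?p i)) * M $$ (?p i, ?p j) * v (?p j))
        = (\<Sum>i<k. \<Sum>b<n. cnj (v (?p i)) * M $$ (?p i, b) * v b)"
      by (intro sum.cong refl restrict[symmetric]) (simp add: v)
    also have "\<dots> = (\<Sum>a<n. \<Sum>b<n. cnj (v a) * M $$ (a, b) * v b)"
      by (rule restrict[symmetric]) (simp add: v)
    finally show ?thesis
      by (simp only: of_real_mult of_real_sum complex_norm_square sum_distrib_left)
  qed
  with ev have "eigen_coordinates M n k I d u" unfolding eigen_coordinates_def by simp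
  then show ?thesis by blast
qed

section \<open>Cauchy interlacing by a dimension count\<close>

text \<open>Padding the coefficient rows of fewer than \<open>n\<close> linear conditions with zero
  rows gives a singular square matrix.\<close>

lemma common_kernel_vector:
  fixes F :: "(nat \<Rightarrow> complex) set"
  assumes "finite F" "card F < n"
  obtains v where "\<exists>a<n. v a \<noteq> 0" "\<And>f. f \<in> F \<Longrightarrow> (\<Sum>a<n. f a * v a) = 0"
proof -
  obtain fs where fs: "set fs = F" "distinct fs" using finite_distinct_list[OF assms(1)] by blast
  have len: "length fs < n" using fs assms(2) distinct_card[of fs] by simp
  define c where "c i = (if i < length fs then vec n (fs ! i) else 0\<^sub>v n)" for i
  define A where "A = mat\<^sub>r n n (\<lambda>i. if i = length fs then 0\<^sub>v n else c i)"
  have A: "A \<in> carrier_mat n n" by (simp add: A_def)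
  have "det A = 0" unfolding A_def by (rule det_row_0[OF len]) (simp add: c_def)
  then obtain w where w: "w \<in> carrier_vec n" "w \<noteq> 0\<^sub>v n" "A *\<^sub>v w = 0\<^sub>v n"
    unfolding det_0_iff_vec_prod_zero[OF A] by blast
  have "\<exists>a<n. w $ a \<noteq> 0"
  proof (rule ccontr)
    assume "\<not> ?thesis"
    then have "w = 0\<^sub>v n" using w(1) by (intro eq_vecI) auto
    then show False using w(2) by contradiction
  qed
  moreover have "(\<Sum>a<n. f a * w $ a) = 0" if "f \<in> F" for f
  proof -
    have "f \<in> set fs" using that fs(1) by simp
    then obtain i where i: "i < length fs" "fs ! i = f" unfolding in_set_conv_nth by blast
    have "row A i = vec n f" using i len by (simp add: A_def c_def)
    then have "vec n f \<bullet> w = (A *\<^sub>v w) $ i" using i len A by simp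
    also have "\<dots> = 0" using w(3) i len by simp
    finally show ?thesis using w(1) by (simp add: scalar_prod_def atLeast0LessThan)
  qed
  ultimately show ?thesis by (rule that)
qed

lemma size_filter_Re_mset:
  "size {# l \<in># image_mset Re (mset (map (\<lambda>l. complex_of_real (d l)) [0..<k])). l \<le> x #}
     = card {l. l < k \<and> d l \<le> x}"
proof -
  have "size {# l \<in># image_mset Re (mset (map (\<lambda>l. complex_of_real (d l)) [0..<k])). l \<le> x #}
      = length (filter (\<lambda>y. y \<le> x) (map d [0..<k]))"
    by (simp only: mset_map[symmetric] mset_filter[symmetric] size_mset list.map_comp o_def Re_complex_of_real)
  also have "\<dots> = card {l. l < k \<and> d l \<le> x}"
    unfolding length_filter_conv_card by (rule arg_cong[where f = card]) auto
  finally show ?thesis .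
qed

text \<open>If the count for \<open>J\<close> exceeded that for \<open>I\<close> by two, there would be a nonzero vector supported
  in \<open>I \<inter> J\<close> on which the form \<open>M - x\<close> is positive by the eigenbasis for \<open>I\<close> and nonpositive by that
  for \<open>J\<close>.\<close>

lemma principal_submatrix_count_le:
  fixes M :: "complex mat"
  assumes M: "M \<in> carrier_mat n n" "hermitian M"
    and I: "I \<in> index_sets n k" and J: "J \<in> index_sets n k" and IJ: "k \<le> card (I \<inter> J) + 1"
  shows "size {# l \<in># image_mset Re (eigenvalues_mset (submatrix M J J)). l \<le> x #}
       \<le> size {# l \<in># image_mset Re (eigenvalues_mset (submatrix M I I)). l \<le> x #} + 1"
proof (rule ccontr)
  assume neg: "\<not> ?thesis"
  obtain d u where du: "eigen_coordinates M n k I d u" using eigen_coordinates_exist[OF M I] by blast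
  obtain e w where ew: "eigen_coordinates M n k J e w" using eigen_coordinates_exist[OF M J] by blast
  note evI = du[unfolded eigen_coordinates_def, THEN conjunct1]
    and evJ = ew[unfolded eigen_coordinates_def, THEN conjunct1]
    and qI = du[unfolded eigen_coordinates_def, THEN conjunct2]
    and qJ = ew[unfolded eigen_coordinates_def, THEN conjunct2]
  let ?S = "{l. l < k \<and> d l \<le> x}" and ?T = "{l. l < k \<and> \<not> e l \<le> x}" and ?K = "{..<n} - I \<inter> J"
  have lt: "card ?S + 1 < card {l. l < k \<and> e l \<le> x}"
    using neg by (simp only: evI evJ size_filter_Re_mset not_le)
  have cT: "card {l. l < k \<and> e l \<le> x} + card ?T = k"
  proof -
    have "card {l. l < k \<and> e l \<le> x} + card ?T = card ({l. l < k \<and> e l \<le> x} \<union> ?T)"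
      by (rule card_Un_disjoint[symmetric]) auto
    also have "{l. l < k \<and> e l \<le> x} \<union> ?T = {..<k}" by auto
    finally show ?thesis by simp
  qed
  have IJn: "I \<inter> J \<subseteq> {..<n}" using I by (auto simp: index_sets_def)
  then have "card ?K = n - card (I \<inter> J)" by (subst card_Diff_subset) (auto intro: finite_subset)
  moreover have "card (I \<inter> J) \<le> n" using card_mono[OF _ IJn] by simp
  ultimately have "card ?K + k \<le> n + 1" using IJ by simp
  \<comment> \<open>The conditions to be imposed, killing the coordinates in \<open>?S\<close> and
    \<open>?T\<close> and the entries in \<open>?K\<close>, are fewer than \<open>n\<close>. An
    excess of two in the counts is what outweighs the bound
    \<open>card ?K + k \<le> n + 1\<close>.\<close>
  with lt cT have lt': "card ?S + card ?T + card ?K < n" by linarith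
  let ?F = "(u ` ?S \<union> w ` ?T) \<union> (\<lambda>a b. if b = a then 1 else 0) ` ?K"
  have "card ?F \<le> card ?S + card ?T + card ?K"
    by (intro order.trans[OF card_Un_le] add_mono card_image_le) auto
  with lt' have "card ?F < n" by linarith
  then obtain v' where v': "\<exists>a<n. v' a \<noteq> 0" "\<And>f. f \<in> ?F \<Longrightarrow> (\<Sum>a<n. f a * v' a) = 0"
    using common_kernel_vector[of ?F n] by auto
  \<comment> \<open>Values beyond \<open>n\<close> are reset to 0, because the support condition
    ranges over all indices.\<close>
  define v where "v a = (if a < n then v' a else 0)" for a
  have v0: "\<exists>a<n. v a \<noteq> 0" using v'(1) by (auto simp: v_def)
  have ker: "(\<Sum>a<n. f a * v a) = 0" if "f \<in> ?F" for f
    using v'(2)[OF that] by (simp add: v_def)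
  have supp: "v a = 0" if "a \<notin> I \<inter> J" for a
  proof (cases "a < n")
    case True
    then have "(\<Sum>b<n. (if b = a then 1 else 0) * v b) = 0" using that by (intro ker) auto
    then show ?thesis using True by (simp add: if_distrib[where f = "\<lambda>z. z * _"] cong: if_cong)
  qed (simp add: v_def)
  let ?y = "\<lambda>l. (cmod (\<Sum>a<n. u l a * v a))\<^sup>2" and ?z = "\<lambda>l. (cmod (\<Sum>a<n. w l a * v a))\<^sup>2"
  let ?N = "\<Sum>a<n. (cmod (v a))\<^sup>2"
  have qI': "(\<Sum>a<n. \<Sum>b<n. cnj (v a) * M $$ (a, b) * v b) - complex_of_real (x * ?N)
       = complex_of_real (\<Sum>l<k. (d l - x) * ?y l)" for x by (rule qI[rule_format]) (use supp in auto)
  \<comment> \<open>Subtracting the identities at \<open>x\<close> and \<open>x + 1\<close> isolates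
    the norm of \<open>v\<close>: Parseval for the coordinates \<open>u\<close>.\<close>
  have sub: "b - a = p - q" if "Q - a = p" "Q - b = q" for Q a b p q :: complex using that by auto
  from sub[OF qI'[of x] qI'[of "x + 1"]]
  have "(x + 1) * ?N - x * ?N = (\<Sum>l<k. (d l - x) * ?y l) - (\<Sum>l<k. (d l - (x + 1)) * ?y l)"
    by (simp only: of_real_eq_iff flip: of_real_diff)
  also have "\<dots> = (\<Sum>l<k. ?y l)"
    by (subst sum_subtractf[symmetric], rule sum.cong) (auto simp: left_diff_distrib distrib_right)
  finally have parseval: "?N = (\<Sum>l<k. ?y l)" by (simp only: distrib_right mult_1 add_diff_cancel_left')
  obtain a where a: "a < n" "v a \<noteq> 0" using v0 by blast
  have "0 < ?N" using a by (intro sum_pos2[of _ a]) auto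
  then have "(\<Sum>l<k. ?y l) \<noteq> 0" unfolding parseval by simp
  then obtain l where l: "l < k" "?y l \<noteq> 0"
    by (rule sum.not_neutral_contains_not_neutral) auto
  have yS: "?y l = 0" if "l < k" "d l \<le> x" for l using ker[of "u l"] that by auto
  have zT: "?z l = 0" if "l < k" "\<not> e l \<le> x" for l using ker[of "w l"] that by auto
  \<comment> \<open>Both sides are the same form at \<open>v\<close>, whose support lies in
    \<open>I\<close> and in \<open>J\<close>. Only eigenvalues at most \<open>x\<close> survive on
    the left, only those above \<open>x\<close> on the right, and by Parseval one of the latter has
    a nonzero coordinate.\<close>
  have "complex_of_real (\<Sum>l<k. (e l - x) * ?z l) = complex_of_real (\<Sum>l<k. (d l - x) * ?y l)"
    using qI'[of x] qJ[rule_format, of v x] supp by (metis (no_types, lifting) IntE)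
  then have eq: "(\<Sum>l<k. (e l - x) * ?z l) = (\<Sum>l<k. (d l - x) * ?y l)" by (simp only: of_real_eq_iff)
  have "(\<Sum>l<k. (e l - x) * ?z l) \<le> 0"
  proof (rule sum_nonpos)
    fix l assume "l \<in> {..<k}"
    then show "(e l - x) * ?z l \<le> 0" using zT[of l] by (cases "e l \<le> x") (auto simp: mult_nonpos_nonneg)
  qed
  moreover have "0 < (\<Sum>l<k. (d l - x) * ?y l)"
  proof (rule sum_pos2[of _ l])
    show "0 < (d l - x) * ?y l" using l yS[of l] by (cases "d l \<le> x") auto
    show "0 \<le> (d l - x) * ?y l" if "l \<in> {..<k}" for l using that yS[of l] by (cases "d l \<le> x") auto
  qed (use l in auto)
  ultimately show False using eq by linarith
qed

subsection \<open>Concentration on subsets of fixed size\<close>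

definition avg :: "'a set \<Rightarrow> ('a \<Rightarrow> real) \<Rightarrow> real" where
  "avg A f = sum f A / real (card A)"

lemma avg_mono:
  assumes "\<And>x. x \<in> A \<Longrightarrow> f x \<le> g x"
  shows "avg A f \<le> avg A g"
  unfolding avg_def by (intro divide_right_mono sum_mono assms) auto

lemma avg_cong: "(\<And>x. x \<in> A \<Longrightarrow> f x = g x) \<Longrightarrow> avg A f = avg A g"
  by (simp add: avg_def)

lemma avg_const: "finite A \<Longrightarrow> A \<noteq> {} \<Longrightarrow> avg A (\<lambda>_. c) = c"
  by (simp add: avg_def)

lemma avg_add: "avg A (\<lambda>x. f x + g x) = avg A f + avg A g"
  by (simp add: avg_def sum.distrib add_divide_distrib)

lemma avg_diff: "avg A (\<lambda>x. f x - g x) = avg A f - avg A g"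
  by (simp add: avg_def sum_subtractf diff_divide_distrib)

lemma avg_minus: "avg A (\<lambda>x. - f x) = - avg A f"
  by (simp add: avg_def sum_negf)

lemma avg_mult_left: "avg A (\<lambda>x. c * f x) = c * avg A f"
  by (simp add: avg_def flip: sum_distrib_left)

lemma avg_mult_right: "avg A (\<lambda>x. f x * c) = avg A f * c"
  by (simp add: avg_def flip: sum_distrib_right)

lemma avg_sum: "avg A (\<lambda>x. \<Sum>i\<in>I. f i x) = (\<Sum>i\<in>I. avg A (f i))"
  unfolding avg_def by (subst sum.swap) (simp add: sum_divide_distrib)

lemma avg_reindex_bij_betw: "bij_betw h A B \<Longrightarrow> avg B f = avg A (\<lambda>x. f (h x))"
  by (simp add: avg_def bij_betw_same_card sum.reindex_bij_betw[symmetric])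

lemma expectation_pmf_of_set_eq_avg:
  "finite A \<Longrightarrow> A \<noteq> {} \<Longrightarrow> measure_pmf.expectation (pmf_of_set A) f = avg A f"
  by (simp add: avg_def integral_pmf_of_set)

text \<open>Since \<open>g\<close> attains its minimum and maximum on \<open>A\<close>, the
  oscillation bound confines it to an interval of length at most \<open>c\<close>, and Hoeffding's
  lemma applies to the uniform distribution.\<close>

lemma hoeffding_avg:
  fixes g :: "'a \<Rightarrow> real"
  assumes fin: "finite A" and ne: "A \<noteq> {}" and l: "l > 0"
    and osc: "\<And>x y. x \<in> A \<Longrightarrow> y \<in> A \<Longrightarrow> \<bar>g x - g y\<bar> \<le> c"
  shows "avg A (\<lambda>x. exp (l * (g x - avg A g))) \<le> exp (l\<^sup>2 * c\<^sup>2 / 8)"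
proof -
  define a b where "a = Min (g ` A)" and "b = Max (g ` A)"
  have ab: "a \<le> g x" "g x \<le> b" if "x \<in> A" for x
    using that fin by (auto simp: a_def b_def)
  interpret interval_bounded_random_variable "measure_pmf (pmf_of_set A)" g a b
    by unfold_locales (use ab fin ne in \<open>auto simp: AE_measure_pmf_iff\<close>)
  have "a \<in> g ` A" "b \<in> g ` A" using fin ne by (auto simp: a_def b_def intro!: Min_in Max_in)
  then have "\<bar>b - a\<bar> \<le> \<bar>c\<bar>" using osc by fastforce
  then have ba: "(b - a)\<^sup>2 \<le> c\<^sup>2" by (rule abs_le_square_iff[THEN iffD1])
  have int: "integrable (measure_pmf (pmf_of_set A)) (\<lambda>x. exp (l * (g x - avg A g)))"
    using fin ne by (intro integrable_measure_pmf_finite) auto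
  have "ennreal (avg A (\<lambda>x. exp (l * (g x - avg A g))))
      = nn_integral (measure_pmf (pmf_of_set A)) (\<lambda>x. exp (l * (g x - avg A g)))"
    using fin ne by (subst nn_integral_eq_integral[OF int]) (auto simp: expectation_pmf_of_set_eq_avg)
  also have "\<dots> \<le> ennreal (exp (l\<^sup>2 * (b - a)\<^sup>2 / 8))"
    using Hoeffdings_lemma_nn_integral[OF l] fin ne by (simp add: expectation_pmf_of_set_eq_avg)
  finally have "avg A (\<lambda>x. exp (l * (g x - avg A g))) \<le> exp (l\<^sup>2 * (b - a)\<^sup>2 / 8)"
    by (simp add: ennreal_le_iff)
  also have "\<dots> \<le> exp (l\<^sup>2 * c\<^sup>2 / 8)" using ba by (simp add: mult_left_mono)
  finally show ?thesis .
qed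

section \<open>Uniform random subsets of fixed size\<close>

definition k_subsets :: "'a set \<Rightarrow> nat \<Rightarrow> 'a set set" where
  "k_subsets S k = {I. I \<subseteq> S \<and> card I = k}"

lemma finite_k_subsets: "finite S \<Longrightarrow> finite (k_subsets S k)"
  by (auto simp: k_subsets_def)

lemma card_k_subsets: "finite S \<Longrightarrow> card (k_subsets S k) = card S choose k"
  by (simp add: k_subsets_def n_subsets)

lemma k_subsets_nonempty: "finite S \<Longrightarrow> k \<le> card S \<Longrightarrow> k_subsets S k \<noteq> {}"
  using card_k_subsets[of S k] by (auto simp: zero_less_binomial_iff)

text \<open>Double counting of pairs of a set and one of its elements: a uniform set of size
  \<open>Suc k\<close> arises by drawing a uniform first element and then a uniform
  \<open>k\<close>-subset of the rest.\<close>

lemma avg_k_subsets_Suc: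
  fixes F :: "'a set \<Rightarrow> real"
  assumes fin: "finite S" and le: "Suc k \<le> card S"
  shows "avg (k_subsets S (Suc k)) F
       = avg S (\<lambda>i. avg (k_subsets (S - {i}) k) (\<lambda>J. F (insert i J)))"
proof -
  let ?n = "card S"
  have "(\<Sum>i\<in>S. \<Sum>J\<in>k_subsets (S - {i}) k. F (insert i J))
      = (\<Sum>(i, J)\<in>Sigma S (\<lambda>i. k_subsets (S - {i}) k). F (insert i J))"
    using fin by (intro sum.Sigma) (auto simp: finite_k_subsets)
  also have "\<dots> = (\<Sum>(I, i)\<in>Sigma (k_subsets S (Suc k)) (\<lambda>I. I). F I)"
  proof (rule sum.reindex_bij_witness[where i = "\<lambda>(I, i). (i, I - {i})" and j = "\<lambda>(i, J). (insert i J, i)"])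
    show "(case p of (i, J) \<Rightarrow> (insert i J, i)) \<in> Sigma (k_subsets S (Suc k)) (\<lambda>I. I)"
      if "p \<in> Sigma S (\<lambda>i. k_subsets (S - {i}) k)" for p
    proof -
      obtain i J where p: "p = (i, J)" "i \<in> S" "J \<subseteq> S - {i}" "card J = k"
        using \<open>p \<in> _\<close> by (auto simp: k_subsets_def)
      then have "finite J" using fin by (auto intro: finite_subset)
      with p have "card (insert i J) = Suc k" by (subst card_insert_disjoint) auto
      with p show ?thesis by (auto simp: k_subsets_def)
    qed
  qed (auto simp: k_subsets_def)
  also have "\<dots> = (\<Sum>I\<in>k_subsets S (Suc k). \<Sum>i\<in>I. F I)"
    using fin by (intro sum.Sigma[symmetric]) (auto simp: finite_k_subsets k_subsets_def intro: finite_subset)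
  also have "\<dots> = real (Suc k) * sum F (k_subsets S (Suc k))"
    unfolding sum_distrib_left by (rule sum.cong) (auto simp: k_subsets_def)
  finally have sums: "(\<Sum>i\<in>S. \<Sum>J\<in>k_subsets (S - {i}) k. F (insert i J))
      = real (Suc k) * sum F (k_subsets S (Suc k))" .
  have card: "real (card (k_subsets (S - {i}) k)) = real ((?n - 1) choose k)" if "i \<in> S" for i
    using that fin by (simp add: card_k_subsets)
  have "avg S (\<lambda>i. avg (k_subsets (S - {i}) k) (\<lambda>J. F (insert i J)))
      = (\<Sum>i\<in>S. (\<Sum>J\<in>k_subsets (S - {i}) k. F (insert i J)) / real ((?n - 1) choose k)) / real ?n"
    unfolding avg_def by (intro arg_cong2[where f = "(/)"] sum.cong refl) (simp only: card)
  also have "\<dots> = real (Suc k) * sum F (k_subsets S (Suc k)) / (real ?n * real ((?n - 1) choose k))"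
    by (simp only: sum_divide_distrib[symmetric] sums divide_divide_eq_left mult.commute)
  \<comment> \<open>The absorption identity turns the denominator into \<open>Suc k\<close> times
    the number of sets, cancelling the multiplicity of each set.\<close>
  also have "real ?n * real ((?n - 1) choose k) = real (Suc k) * real (?n choose Suc k)"
    using times_binomial_minus1_eq[of "Suc k" ?n] by (simp flip: of_nat_mult del: of_nat_Suc)
  finally show ?thesis using fin by (simp add: avg_def card_k_subsets del: of_nat_Suc)
qed

text \<open>Coupling by the transposition of \<open>i\<close> and \<open>j\<close>: it maps
  completions of \<open>{i}\<close> to completions of \<open>{j}\<close>, and the two completed sets
  either coincide or differ by this one exchange.\<close>

lemma avg_k_subsets_swap:
  fixes f :: "'a set \<Rightarrow> real"
  assumes fin: "finite S" and le: "Suc k \<le> card S" and ij: "i \<in> S" "j \<in> S" and c: "c \<ge> 0"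
    and lip: "\<And>K i j. K \<subseteq> S \<Longrightarrow> card K = k \<Longrightarrow> i \<in> S - K \<Longrightarrow> j \<in> S - K \<Longrightarrow>
      \<bar>f (insert i K) - f (insert j K)\<bar> \<le> c"
  shows "avg (k_subsets (S - {i}) k) (\<lambda>J. f (insert i J))
     - avg (k_subsets (S - {j}) k) (\<lambda>J. f (insert j J)) \<le> c"
proof -
  let ?t = "Transposition.transpose i j" and ?A = "k_subsets (S - {i}) k"
  have inj: "inj_on ?t J" for J by (auto simp: inj_on_def Transposition.transpose_def split: if_splits)
  have img: "?t ` J \<in> k_subsets (S - {b}) k" if "J \<in> k_subsets (S - {a}) k" "{a, b} = {i, j}" for J a b
    using that ij card_image[OF inj, of J]
    by (auto simp: k_subsets_def Transposition.transpose_def doubleton_eq_iff split: if_splits)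
  have bij: "bij_betw ((`) ?t) ?A (k_subsets (S - {j}) k)"
    by (rule bij_betw_byWitness[where f' = "(`) ?t"])
       (auto simp: image_image intro: img)
  have "k \<le> card (S - {i})" using fin le ij by simp
  then have A: "finite ?A" "?A \<noteq> {}" using fin by (simp_all add: finite_k_subsets k_subsets_nonempty)
  have "f (insert i J) - f (insert j (?t ` J)) \<le> c" if "J \<in> ?A" for J
  proof (cases "j \<in> J")
    case True
    have "?t ` J = insert i (J - {j})"
      using True that by (auto simp: k_subsets_def Transposition.transpose_def image_iff)
    then have "insert j (?t ` J) = insert i J" using True by auto
    then show ?thesis using c by simp
  next
    case False
    have "?t ` J = J" using False that by (force simp: k_subsets_def Transposition.transpose_def image_iff)
    moreover have "\<bar>f (insert i J) - f (insert j J)\<bar> \<le> c"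
      using that False ij by (intro lip) (auto simp: k_subsets_def)
    ultimately show ?thesis by simp
  qed
  then have "avg ?A (\<lambda>J. f (insert i J) - f (insert j (?t ` J))) \<le> avg ?A (\<lambda>_. c)"
    by (rule avg_mono)
  then show ?thesis
    by (simp only: avg_diff avg_const[OF A] avg_reindex_bij_betw[OF bij])
qed

text \<open>Revealing the elements of the random subset one by one turns \<open>f\<close> into a martingale with \<open>k\<close>
  increments, each of oscillation at most \<open>c\<close>; the induction peels off the first increment.\<close>

lemma k_subsets_mgf_bound:
  fixes f :: "'a set \<Rightarrow> real"
  assumes "finite S" and "k \<le> card S" and "l > 0" and "c \<ge> 0"
    and "\<And>K i j. K \<subseteq> S \<Longrightarrow> Suc (card K) = k \<Longrightarrow> i \<in> S - K \<Longrightarrow> j \<in> S - K \<Longrightarrow>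
      \<bar>f (insert i K) - f (insert j K)\<bar> \<le> c"
  shows "avg (k_subsets S k) (\<lambda>I. exp (l * (f I - avg (k_subsets S k) f)))
       \<le> exp (l\<^sup>2 * real k * c\<^sup>2 / 8)"
  using assms
proof (induction k arbitrary: S f)
  case (0 S f)
  have "k_subsets S 0 = {{}}" using 0(1) by (auto simp: k_subsets_def finite_subset)
  then show ?case by (simp add: avg_def)
next
  case (Suc k S f)
  note fin = Suc.prems(1) and le = Suc.prems(2) and lip = Suc.prems(5)
  define g where "g i = avg (k_subsets (S - {i}) k) (\<lambda>J. f (insert i J))" for i
  define m where "m = avg (k_subsets S (Suc k)) f"
  have m: "m = avg S g" unfolding m_def g_def by (rule avg_k_subsets_Suc[OF fin le])
  have S: "S \<noteq> {}" using le by auto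
  \<comment> \<open>Once \<open>i\<close> is revealed, the remaining choice inherits the bounded
    differences, with \<open>insert i K\<close> as the common part.\<close>
  have IH: "avg (k_subsets (S - {i}) k) (\<lambda>J. exp (l * (f (insert i J) - g i))) \<le> exp (l\<^sup>2 * real k * c\<^sup>2 / 8)"
    if i: "i \<in> S" for i
    unfolding g_def
  proof (rule Suc.IH)
    fix K a b assume K: "K \<subseteq> S - {i}" "Suc (card K) = k" "a \<in> S - {i} - K" "b \<in> S - {i} - K"
    have "finite K" using K(1) fin by (auto intro: finite_subset)
    with K have "card (insert i K) = k" by (subst card_insert_disjoint) auto
    then have "\<bar>f (insert a (insert i K)) - f (insert b (insert i K))\<bar> \<le> c"
      using K i by (intro lip) auto
    then show "\<bar>f (insert i (insert a K)) - f (insert i (insert b K))\<bar> \<le> c"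
      by (simp only: insert_commute)
  qed (use fin le i Suc.prems in auto)
  have osc: "\<bar>g i - g j\<bar> \<le> c" if "i \<in> S" "j \<in> S" for i j
  proof -
    have "g i - g j \<le> c" if "i \<in> S" "j \<in> S" for i j
      unfolding g_def by (rule avg_k_subsets_swap[OF fin le that Suc.prems(4)]) (rule lip, auto)
    from this[OF that] this[OF that(2,1)] show ?thesis by linarith
  qed
  have "avg (k_subsets S (Suc k)) (\<lambda>I. exp (l * (f I - m)))
      = avg S (\<lambda>i. avg (k_subsets (S - {i}) k) (\<lambda>J. exp (l * (f (insert i J) - m))))"
    by (rule avg_k_subsets_Suc[OF fin le])
  \<comment> \<open>The exponent splits into \<open>f (insert i J) - g i\<close>, left to the
    induction hypothesis, and the first increment \<open>g i - m\<close>, which does not depend on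
    \<open>J\<close>.\<close>
  also have "\<dots> = avg S (\<lambda>i. avg (k_subsets (S - {i}) k) (\<lambda>J. exp (l * (f (insert i J) - g i))) * exp (l * (g i - m)))"
    unfolding avg_mult_right[symmetric] by (simp add: algebra_simps flip: exp_add)
  also have "\<dots> \<le> avg S (\<lambda>i. exp (l\<^sup>2 * real k * c\<^sup>2 / 8) * exp (l * (g i - m)))"
    by (intro avg_mono mult_right_mono IH) auto
  also have "\<dots> \<le> exp (l\<^sup>2 * real k * c\<^sup>2 / 8) * exp (l\<^sup>2 * c\<^sup>2 / 8)"
    unfolding avg_mult_left m
    by (intro mult_left_mono hoeffding_avg[OF fin S] osc) (use Suc.prems in auto)
  also have "\<dots> = exp (l\<^sup>2 * real (Suc k) * c\<^sup>2 / 8)"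
    unfolding exp_add[symmetric] by (simp add: field_simps)
  finally show ?case unfolding m_def .
qed

subsection \<open>From pointwise bounds to the supremum norm\<close>

text \<open>Moving left never raises a monotone function, so the smaller of a common minimizer for
  \<open>W\<close> and a minimizer for one further function serves both. Finite ranges ensure that
  minima are attained.\<close>

lemma common_minimizer:
  fixes G :: "'a \<Rightarrow> real \<Rightarrow> real"
  assumes fin: "finite W" and C: "C \<noteq> {}"
    and mono: "\<And>w. w \<in> W \<Longrightarrow> mono (G w)" and ran: "\<And>w. w \<in> W \<Longrightarrow> finite (range (G w))"
  shows "\<exists>a\<in>C. \<forall>w\<in>W. \<forall>x\<in>C. G w a \<le> G w x"
  using fin mono ran
proof (induction W)
  case empty
  then show ?case using C by auto
next
  case (insert w W)
  then have "\<exists>a\<in>C. \<forall>v\<in>W. \<forall>x\<in>C. G v a \<le> G v x"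
    by (intro insert.IH) simp_all
  then obtain a where a: "a \<in> C" "\<And>v x. v \<in> W \<Longrightarrow> x \<in> C \<Longrightarrow> G v a \<le> G v x" by blast
  have fin: "finite (G w ` C)" by (rule finite_subset[OF _ insert.prems(2)[of w]]) auto
  then have "Min (G w ` C) \<in> G w ` C" using C by (intro Min_in) auto
  then obtain b where b: "b \<in> C" "G w b = Min (G w ` C)" by auto
  have b': "G w b \<le> G w x" if "x \<in> C" for x using b fin that by simp
  have m: "mono (G v)" if "v \<in> insert w W" for v using insert.prems(1) that by blast
  have "G v (min a b) \<le> G v x" if "v \<in> insert w W" "x \<in> C" for v x
  proof -
    have "G v (min a b) \<le> G v a" "G v (min a b) \<le> G v b"
      by (rule monoD[OF m[OF that(1)]], simp)+
    moreover have "G v a \<le> G v x \<or> G v b \<le> G v x" using a(2)[of v x] b'[of x] that by auto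
    ultimately show ?thesis by linarith
  qed
  moreover have "min a b \<in> C" using a b by (simp add: min_def)
  ultimately show ?case by blast
qed

text \<open>The reflection \<open>- G w (- x)\<close> keeps monotonicity and exchanges minima with
  maxima.\<close>

lemma common_maximizer:
  fixes G :: "'a \<Rightarrow> real \<Rightarrow> real"
  assumes fin: "finite W" and C: "C \<noteq> {}"
    and mono: "\<And>w. w \<in> W \<Longrightarrow> mono (G w)" and ran: "\<And>w. w \<in> W \<Longrightarrow> finite (range (G w))"
  shows "\<exists>b\<in>C. \<forall>w\<in>W. \<forall>x\<in>C. G w x \<le> G w b"
proof -
  have "\<exists>a\<in>uminus ` C. \<forall>w\<in>W. \<forall>x\<in>uminus ` C. - G w (- a) \<le> - G w (- x)"
  proof (rule common_minimizer[OF fin])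
    fix w assume w: "w \<in> W"
    show "mono (\<lambda>x. - G w (- x))" using mono[OF w] by (auto simp: mono_def)
    have "range (\<lambda>x. - G w (- x)) \<subseteq> uminus ` range (G w)" by auto
    then show "finite (range (\<lambda>x. - G w (- x)))" by (rule finite_subset) (use ran[OF w] in simp)
  qed (use C in auto)
  then show ?thesis by auto
qed

text \<open>The pieces are the level sets of \<open>\<lfloor>N F\<rfloor>\<close>. Since the \<open>G w\<close> are monotone with finite range, they
  all attain their extrema over a piece at common points \<open>a\<close> and \<open>b\<close>, so no one-sided limits are
  needed.\<close>

lemma avg_exp_sup_norm_le:
  fixes G :: "'a \<Rightarrow> real \<Rightarrow> real"
  assumes fin: "finite W" and W: "W \<noteq> {}"
    and mono: "\<And>w. w \<in> W \<Longrightarrow> mono (G w)" and ran: "\<And>w. w \<in> W \<Longrightarrow> finite (range (G w))"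
    and bnd: "\<And>w x. w \<in> W \<Longrightarrow> 0 \<le> G w x \<and> G w x \<le> 1"
    and F: "\<And>x. F x = avg W (\<lambda>w. G w x)"
    and s: "s > 0" and N: "s \<le> real N"
    and upper: "\<And>x. avg W (\<lambda>w. exp (s * (G w x - F x))) \<le> E"
    and lower: "\<And>x. avg W (\<lambda>w. exp (s * (F x - G w x))) \<le> E"
  shows "avg W (\<lambda>w. exp (s * sup_norm (\<lambda>x. G w x - F x))) \<le> exp 1 * (2 * (real N + 1) * E)"
proof -
  have N0: "real N > 0" using s N by linarith
  have F0: "0 \<le> F x" for x
    unfolding F avg_def using bnd by (intro divide_nonneg_nonneg sum_nonneg) auto
  have F1: "F x \<le> 1" for x
  proof -
    have "F x \<le> avg W (\<lambda>_. 1)" unfolding F by (rule avg_mono) (use bnd in blast)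
    then show ?thesis using fin W by (simp add: avg_const)
  qed
  \<comment> \<open>Truncation gives at most \<open>N + 1\<close> pieces, the last of them where
    \<open>F\<close> equals 1, and \<open>F\<close> varies by at most \<open>1 / N\<close> on
    each.\<close>
  define cls where "cls x = nat \<lfloor>real N * F x\<rfloor>" for x
  have cls_le: "cls x \<le> N" for x
  proof -
    have "real N * F x \<le> real N" using F1[of x] N0 by simp
    then show ?thesis unfolding cls_def by linarith
  qed
  have close: "F x - F y \<le> 1 / real N" if "cls x = cls y" for x y
  proof -
    have "0 \<le> real N * F x" "0 \<le> real N * F y" using F0 N0 by auto
    then have "real N * F x - real N * F y \<le> 1" using that unfolding cls_def by linarith
    then show ?thesis using N0 by (simp add: field_simps)
  qed
  \<comment> \<open>For an empty piece the claim is vacuous, so a point can be chosen for every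
    index.\<close>
  have "\<exists>a. \<forall>x. cls x = i \<longrightarrow> cls a = i \<and> (\<forall>w\<in>W. G w a \<le> G w x)" for i
  proof (cases "{x. cls x = i} = {}")
    case False
    have "\<exists>a\<in>{x. cls x = i}. \<forall>w\<in>W. \<forall>x\<in>{x. cls x = i}. G w a \<le> G w x"
      by (rule common_minimizer[OF fin False mono ran])
    then show ?thesis by auto
  qed auto
  then have "\<forall>i. \<exists>a. \<forall>x. cls x = i \<longrightarrow> cls a = i \<and> (\<forall>w\<in>W. G w a \<le> G w x)" by blast
  from choice[OF this] obtain a
    where a: "\<forall>i x. cls x = i \<longrightarrow> cls (a i) = i \<and> (\<forall>w\<in>W. G w (a i) \<le> G w x)" ..
  have "\<exists>b. \<forall>x. cls x = i \<longrightarrow> cls b = i \<and> (\<forall>w\<in>W. G w x \<le> G w b)" for i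
  proof (cases "{x. cls x = i} = {}")
    case False
    have "\<exists>b\<in>{x. cls x = i}. \<forall>w\<in>W. \<forall>x\<in>{x. cls x = i}. G w x \<le> G w b"
      by (rule common_maximizer[OF fin False mono ran])
    then show ?thesis by auto
  qed auto
  then have "\<forall>i. \<exists>b. \<forall>x. cls x = i \<longrightarrow> cls b = i \<and> (\<forall>w\<in>W. G w x \<le> G w b)" by blast
  from choice[OF this] obtain b
    where b: "\<forall>i x. cls x = i \<longrightarrow> cls (b i) = i \<and> (\<forall>w\<in>W. G w x \<le> G w (b i))" ..
  define Z where "Z w i = exp (s * (G w (b i) - F (b i))) + exp (s * (F (a i) - G w (a i)))" for w i
  have pt: "exp (s * \<bar>G w x - F x\<bar>) \<le> exp 1 * (\<Sum>i\<le>N. Z w i)" if w: "w \<in> W" for w x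
  proof -
    let ?i = "cls x"
    have sN: "s * (1 / real N) \<le> 1" using N N0 by simp
    \<comment> \<open>Replacing \<open>x\<close> by the extremal point of its piece loses at most
      the variation \<open>1 / N\<close> of \<open>F\<close>. As \<open>s \<le> N\<close>, this
      costs a factor \<open>exp 1\<close> after exponentiation.\<close>
    have up: "G w x - F x \<le> G w (b ?i) - F (b ?i) + 1 / real N"
      using b[rule_format, of x ?i] w close[of "b ?i" x] by force
    have lo: "F x - G w x \<le> F (a ?i) - G w (a ?i) + 1 / real N"
      using a[rule_format, of x ?i] w close[of x "a ?i"] by force
    have key: "exp (s * y) \<le> exp 1 * exp (s * z)" if "y \<le> z + 1 / real N" for y z
    proof -
      have "s * y \<le> s * (z + 1 / real N)" using that s by (intro mult_left_mono) auto
      also have "\<dots> \<le> 1 + s * z" using sN by (simp add: distrib_left)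
      finally show ?thesis by (simp flip: exp_add)
    qed
    have "exp (s * \<bar>G w x - F x\<bar>) \<le> exp 1 * Z w ?i"
    proof (cases "G w x \<ge> F x")
      case True
      then have "exp (s * \<bar>G w x - F x\<bar>) \<le> exp 1 * exp (s * (G w (b ?i) - F (b ?i)))"
        using key[OF up] by simp
      also have "\<dots> \<le> exp 1 * Z w ?i" by (intro mult_left_mono) (auto simp: Z_def)
      finally show ?thesis .
    next
      case False
      then have "exp (s * \<bar>G w x - F x\<bar>) \<le> exp 1 * exp (s * (F (a ?i) - G w (a ?i)))"
        using key[OF lo] by simp
      also have "\<dots> \<le> exp 1 * Z w ?i" by (intro mult_left_mono) (auto simp: Z_def)
      finally show ?thesis .
    qed
    also have "Z w ?i \<le> (\<Sum>i\<le>N. Z w i)"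
      using cls_le[of x] by (intro member_le_sum) (auto simp: Z_def add_nonneg_nonneg)
    finally show ?thesis by simp
  qed
  \<comment> \<open>The right side of \<open>pt\<close> is independent of \<open>x\<close>, so its
    logarithm over \<open>s\<close> bounds all deviations and hence their supremum.\<close>
  have "exp (s * sup_norm (\<lambda>x. G w x - F x)) \<le> exp 1 * (\<Sum>i\<le>N. Z w i)" if w: "w \<in> W" for w
  proof -
    let ?R = "exp 1 * (\<Sum>i\<le>N. Z w i)"
    have R: "?R > 0" using order.strict_trans2[OF exp_gt_zero pt[OF w]] .
    have "\<bar>G w x - F x\<bar> \<le> ln ?R / s" for x
      using pt[OF w, of x] R s by (simp add: field_simps ln_ge_iff)
    then have "sup_norm (\<lambda>x. G w x - F x) \<le> ln ?R / s"
      unfolding sup_norm_def by (intro cSUP_least) auto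
    then have "s * sup_norm (\<lambda>x. G w x - F x) \<le> ln ?R" using s by (simp add: field_simps)
    then show ?thesis using R by (simp only: ln_ge_iff)
  qed
  then have "avg W (\<lambda>w. exp (s * sup_norm (\<lambda>x. G w x - F x))) \<le> avg W (\<lambda>w. exp 1 * (\<Sum>i\<le>N. Z w i))"
    by (rule avg_mono)
  also have "\<dots> = exp 1 * (\<Sum>i\<le>N. avg W (\<lambda>w. Z w i))" by (simp only: avg_mult_left avg_sum)
  \<comment> \<open>Each of the \<open>N + 1\<close> pieces contributes one upper and one lower
    deviation.\<close>
  also have "\<dots> \<le> exp 1 * (\<Sum>i\<le>N. 2 * E)"
  proof (intro mult_left_mono sum_mono)
    show "avg W (\<lambda>w. Z w i) \<le> 2 * E" for i
      unfolding Z_def avg_add using upper[of "b i"] lower[of "a i"] by linarith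
  qed simp
  also have "\<dots> = exp 1 * (2 * (real N + 1) * E)" by (simp add: algebra_simps)
  finally show ?thesis .
qed

section \<open>Tail and expectation from the exponential moment\<close>

text \<open>The offset \<open>k powr (-1/2)\<close> in the threshold contributes
  \<open>exp (-1)\<close> at exponent \<open>sqrt k\<close>, which cancels the \<open>exp 1\<close>
  of the moment bound.\<close>

lemma deviation_bounds:
  fixes X :: "'a \<Rightarrow> real" and k :: nat
  assumes fin: "finite W" and W: "W \<noteq> {}" and k: "1 \<le> k"
    and mgf: "avg W (\<lambda>w. exp (sqrt (real k) * X w)) \<le> 12 * exp 1 * sqrt (real k)"
  shows "r \<ge> 0 \<Longrightarrow> measure_pmf.prob (pmf_of_set W) {w. X w \<ge> real k powr (-1/2) + r}
          \<le> 12 * sqrt (real k) * exp (- r * sqrt (real k / 8))"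
    and "measure_pmf.expectation (pmf_of_set W) X \<le> (13 + sqrt 8 * ln (real k)) / sqrt (real k)"
proof -
  define s where "s = sqrt (real k)"
  have s: "s \<ge> 1" using k by (simp add: s_def)
  have mgf': "avg W (\<lambda>w. exp (s * X w)) \<le> 12 * exp 1 * s" using mgf by (simp add: s_def)
  have powr: "real k powr (-1/2) = 1 / s"
    using k by (simp add: s_def powr_minus powr_half_sqrt inverse_eq_divide powr_minus_divide)
  {
    assume r: "r \<ge> 0"
    let ?T = "{w. X w \<ge> real k powr (-1/2) + r}"
    have "measure_pmf.prob (pmf_of_set W) ?T = avg W (\<lambda>w. if w \<in> ?T then 1 else 0)"
      using fin W by (simp add: measure_pmf_of_set avg_def sum.If_cases Int_def)
    also have "\<dots> \<le> avg W (\<lambda>w. exp (- 1 - s * r) * exp (s * X w))"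
    proof (rule avg_mono)
      fix w
      show "(if w \<in> ?T then 1 else 0) \<le> exp (- 1 - s * r) * exp (s * X w)"
      proof (cases "w \<in> ?T")
        case True
        then have "s * (1 / s + r) \<le> s * X w" using s unfolding powr by (intro mult_left_mono) auto
        then have "0 \<le> - 1 - s * r + s * X w" using s by (simp add: distrib_left)
        then show ?thesis using True by (simp flip: exp_add)
      qed simp
    qed
    also have "\<dots> \<le> exp (- 1 - s * r) * (12 * exp 1 * s)"
      unfolding avg_mult_left using mgf' by (intro mult_left_mono) auto
    also have "\<dots> = 12 * s * exp (- (s * r))"
      by (simp add: exp_diff exp_minus field_simps)
    \<comment> \<open>Markov's inequality has produced the rate \<open>sqrt k\<close>; the claimed
      rate \<open>sqrt (k / 8)\<close> is weaker.\<close>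
    also have "\<dots> \<le> 12 * s * exp (- r * sqrt (real k / 8))"
    proof -
      have "r * sqrt (real k / 8) \<le> r * s" unfolding s_def using r by (intro mult_left_mono) auto
      then show ?thesis using s by (simp add: mult.commute)
    qed
    finally show "measure_pmf.prob (pmf_of_set W) ?T \<le> 12 * sqrt (real k) * exp (- r * sqrt (real k / 8))"
      by (simp add: s_def)
  }
  \<comment> \<open>A tangent line of the exponential, its point of contact chosen so that the last
    term averages to at most 1.\<close>
  have pt: "s * X w \<le> ln (12 * s) + exp (s * X w) / (12 * exp 1 * s)" for w
  proof -
    have "1 + (s * X w - 1 - ln (12 * s)) \<le> exp (s * X w - 1 - ln (12 * s))" by (rule exp_ge_add_one_self)
    also have "\<dots> = exp (s * X w) / (12 * exp 1 * s)" using s by (simp add: exp_diff)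
    finally show ?thesis by simp
  qed
  have "s * avg W X \<le> avg W (\<lambda>w. ln (12 * s) + exp (s * X w) / (12 * exp 1 * s))"
    unfolding avg_mult_left[symmetric] by (rule avg_mono) (rule pt)
  also have "\<dots> = ln (12 * s) + avg W (\<lambda>w. exp (s * X w)) / (12 * exp 1 * s)"
    unfolding avg_add divide_inverse avg_mult_right avg_const[OF fin W] ..
  also have "\<dots> \<le> ln (12 * s) + 1" using mgf' s by simp
  also have "ln (12 * s) = ln 12 + ln (real k) / 2" using s k by (simp add: ln_mult s_def ln_sqrt)
  \<comment> \<open>Generous estimates: \<open>11 + 1\<close> stays below 13, and the coefficient
    1/2 of the logarithm below \<open>sqrt 8\<close>.\<close>
  also have "ln 12 \<le> (11 :: real)" using ln_le_minus_one[of "12 :: real"] by simp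
  also have "ln (real k) / 2 \<le> sqrt 8 * ln (real k)"
  proof -
    have "1 / 2 \<le> sqrt (8 :: real)" by (rule real_le_rsqrt) (simp add: power2_eq_square)
    moreover have "0 \<le> ln (real k)" using k by simp
    ultimately show ?thesis using mult_right_mono[of "1 / 2" "sqrt 8" "ln (real k)"] by simp
  qed
  finally have "s * avg W X \<le> 13 + sqrt 8 * ln (real k)" by simp
  then have "avg W X \<le> (13 + sqrt 8 * ln (real k)) / s" using s by (simp add: pos_le_divide_eq mult.commute)
  then show "measure_pmf.expectation (pmf_of_set W) X \<le> (13 + sqrt 8 * ln (real k)) / sqrt (real k)"
    using fin W by (simp add: expectation_pmf_of_set_eq_avg s_def)
qed

subsection \<open>Spectra of random submatrices\<close>

lemma hermitian_mult_adjoint: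
  assumes "M \<in> carrier_mat n n"
  shows "hermitian (M * mat_adjoint M)"
proof -
  have "mat_adjoint M \<in> carrier_mat n n" using assms by (rule mat_adjoint_carrier)
  then show ?thesis
    using assms by (simp add: hermitian_def mat_adjoint_mult[of _ n n _ n])
qed

text \<open>Entry \<open>(i, j)\<close> of either side is the inner product of rows
  \<open>pick I i\<close> and \<open>pick I j\<close> of \<open>M\<close>.\<close>

lemma row_submatrix_mult_adjoint:
  fixes M :: "complex mat"
  assumes M: "M \<in> carrier_mat n n" and I: "I \<in> index_sets n k"
  defines "B \<equiv> submatrix M I {..<n}"
  shows "B * mat_adjoint B = submatrix (M * mat_adjoint M) I I"
proof -
  have In: "{i. i < n \<and> i \<in> I} = I" using I by (auto simp: index_sets_def)
  have nn: "{j. j < n \<and> j \<in> {..<n}} = {..<n}" by auto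
  \<comment> \<open>All columns are kept and enumerated in order, so column indices do not
    change.\<close>
  have pick_n: "pick {..<n} l = l" if "l < n" for l
  proof -
    have "{a \<in> {..<n}. a < l} = {..<l}" using that by auto
    then show ?thesis using pick_card_in_set[of l "{..<n}"] that by simp
  qed
  have Bc: "B \<in> carrier_mat k n"
    using M I In nn by (auto simp: B_def submatrix_def index_sets_def)
  have Bij: "B $$ (i, l) = M $$ (pick I i, l)" if "i < k" "l < n" for i l
    using M I In nn that by (simp add: B_def submatrix_def index_sets_def pick_n)
  have M': "mat_adjoint M \<in> carrier_mat n n" using M by (rule mat_adjoint_carrier)
  have H: "M * mat_adjoint M \<in> carrier_mat n n" using M M' by (rule mult_carrier_mat)
  note S = principal_submatrix_carrier[OF H I]
  show "B * mat_adjoint B = submatrix (M * mat_adjoint M) I I"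
  proof (rule eq_matI)
    fix i j
    assume "i < dim_row (submatrix (M * mat_adjoint M) I I)"
      "j < dim_col (submatrix (M * mat_adjoint M) I I)"
    then have ij: "i < k" "j < k" using S by auto
    have "(B * mat_adjoint B) $$ (i, j) = (\<Sum>l<n. M $$ (pick I i, l) * cnj (M $$ (pick I j, l)))"
      using Bc ij by (simp add: scalar_prod_def atLeast0LessThan mat_adjoint_complex Bij)
    also have "\<dots> = (M * mat_adjoint M) $$ (pick I i, pick I j)"
      using M pick_less[OF I] ij by (simp add: scalar_prod_def atLeast0LessThan mat_adjoint_complex)
    finally show "(B * mat_adjoint B) $$ (i, j) = submatrix (M * mat_adjoint M) I I $$ (i, j)"
      by (simp only: principal_submatrix_index[OF H I ij])
  qed (use Bc S in \<open>auto simp: mat_adjoint_complex\<close>)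
qed

text \<open>\<open>sqrt\<close> extends to negative reals as an odd function; the signed square is
  its inverse on the whole line.\<close>

lemma sqrt_signed_square: "sqrt (sgn x * x\<^sup>2) = x"
  by (cases x "0 :: real" rule: linorder_cases) (auto simp: real_sqrt_minus)

lemma sqrt_le_iff_le_signed_square: "sqrt l \<le> x \<longleftrightarrow> l \<le> sgn x * x\<^sup>2"
  using real_sqrt_le_iff[of l "sgn x * x\<^sup>2"] by (simp add: sqrt_signed_square)

text \<open>Since \<open>sqrt\<close> is an odd increasing bijection of the reals, this needs no positivity of the
  eigenvalues.\<close>

lemma singular_distr_eq_spectral_distr:
  "singular_distr A x = spectral_distr (A * mat_adjoint A) (sgn x * x\<^sup>2)"
  by (simp add: singular_distr_def spectral_distr_def singular_values_mset_def filter_mset_image_mset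
      sqrt_le_iff_le_signed_square)

text \<open>The signed square maps onto the reals, so the supremum runs over the same
  values.\<close>

lemma sup_norm_signed_square: "sup_norm (\<lambda>x. g (sgn x * x\<^sup>2)) = sup_norm g"
proof -
  have "y \<in> range (\<lambda>x. sgn x * x\<^sup>2)" for y :: real
  proof
    show "y = sgn (sqrt y) * (sqrt y)\<^sup>2"
      using sqrt_signed_square[of "sqrt y"] by (simp only: real_sqrt_eq_iff)
  qed simp
  then have "range (\<lambda>x. sgn x * x\<^sup>2) = (UNIV :: real set)" by blast
  then have "range (\<lambda>x. \<bar>g (sgn x * x\<^sup>2)\<bar>) = range (\<lambda>x. \<bar>g x\<bar>)"
    using image_image[of "\<lambda>y. \<bar>g y\<bar>" "\<lambda>x :: real. sgn x * x\<^sup>2" UNIV] by simp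
  then show ?thesis by (simp only: sup_norm_def)
qed

section \<open>Random principal submatrices\<close>

lemma index_sets_eq_k_subsets: "index_sets n k = k_subsets {..<n} k"
  by (simp add: index_sets_def k_subsets_def)

lemma index_sets_finite_nonempty:
  assumes "k \<le> n"
  shows "finite (index_sets n k)" "index_sets n k \<noteq> {}"
  using assms by (simp_all add: index_sets_eq_k_subsets finite_k_subsets k_subsets_nonempty)

lemma spectral_distr_mono: "mono (spectral_distr A)"
  unfolding spectral_distr_def
  by (intro monoI divide_right_mono of_nat_mono size_mset_mono filter_mset_mono_strong) auto

lemma finite_range_spectral_distr: "finite (range (spectral_distr A))"
proof (rule finite_subset)
  show "range (spectral_distr A)
      \<subseteq> (\<lambda>m. real m / real (dim_row A)) ` {..size (image_mset Re (eigenvalues_mset A))}"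
    unfolding spectral_distr_def using size_filter_mset_lesseq by blast
qed simp

lemma spectral_distr_bounds:
  assumes A: "A \<in> carrier_mat k k"
  shows "0 \<le> spectral_distr A x \<and> spectral_distr A x \<le> 1"
proof -
  have "size {# l \<in># image_mset Re (eigenvalues_mset A). l \<le> x #} \<le> size (eigenvalues_mset A)"
    using size_filter_mset_lesseq[of _ "image_mset Re (eigenvalues_mset A)"] by simp
  also have "\<dots> = k"
    using degree_monic_char_poly[OF A] by (simp add: eigenvalues_mset_def size_proots_complex)
  finally show ?thesis using A by (auto simp: spectral_distr_def divide_le_eq)
qed

text \<open>Both index sets contain \<open>K\<close>, hence share all but at most one element, and
  interlacing bounds the change of the count in either direction. This is the bounded difference
  hypothesis of the moment bound.\<close>

lemma spectral_distr_swap: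
  fixes M :: "complex mat"
  assumes M: "M \<in> carrier_mat n n" "hermitian M" and K: "K \<subseteq> {..<n}" "Suc (card K) = k"
    and ij: "i \<in> {..<n} - K" "j \<in> {..<n} - K"
  shows "\<bar>spectral_distr (submatrix M (insert i K) (insert i K)) x
     - spectral_distr (submatrix M (insert j K) (insert j K)) x\<bar> \<le> 1 / real k"
proof -
  let ?G = "\<lambda>i. spectral_distr (submatrix M (insert i K) (insert i K)) x"
  have fin: "finite K" using K by (auto intro: finite_subset)
  have idx: "insert a K \<in> index_sets n k" if "a \<in> {..<n} - K" for a
    using that K fin by (auto simp: index_sets_def)
  have le: "?G a \<le> ?G b + 1 / real k" if "a \<in> {..<n} - K" "b \<in> {..<n} - K" for a b
  proof -
    have "card K \<le> card (insert b K \<inter> insert a K)" using fin by (intro card_mono) auto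
    then have "k \<le> card (insert b K \<inter> insert a K) + 1" using K by simp
    from principal_submatrix_count_le[OF M idx[OF that(2)] idx[OF that(1)] this, of x]
    have "real (size {# l \<in># image_mset Re (eigenvalues_mset (submatrix M (insert a K) (insert a K))). l \<le> x #})
        \<le> real (size {# l \<in># image_mset Re (eigenvalues_mset (submatrix M (insert b K) (insert b K))). l \<le> x #}) + 1"
      by linarith
    moreover have "dim_row (submatrix M (insert a K) (insert a K)) = k"
      "dim_row (submatrix M (insert b K) (insert b K)) = k"
      using principal_submatrix_carrier[OF M(1) idx] that by auto
    ultimately show ?thesis
      unfolding spectral_distr_def by (simp add: divide_right_mono flip: add_divide_distrib)
  qed
  show ?thesis using le[OF ij] le[OF ij(2,1)] by linarith
qed

lemma avg_exp_sup_norm_spectral_distr: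
  fixes M :: "complex mat"
  assumes M: "M \<in> carrier_mat n n" "hermitian M" and k: "1 \<le> k" "k \<le> n"
  defines "F \<equiv> \<lambda>x. avg (index_sets n k) (\<lambda>I. spectral_distr (submatrix M I I) x)"
  shows "avg (index_sets n k)
      (\<lambda>I. exp (sqrt (real k) * sup_norm (\<lambda>x. spectral_distr (submatrix M I I) x - F x)))
    \<le> 12 * exp 1 * sqrt (real k)"
proof -
  let ?G = "\<lambda>I. spectral_distr (submatrix M I I)" and ?s = "sqrt (real k)"
  \<comment> \<open>The least integer satisfying the condition \<open>s \<le> N\<close> on the
    number of pieces.\<close>
  define N where "N = nat \<lceil>?s\<rceil>"
  have s1: "1 \<le> ?s" using k by simp
  have N: "?s \<le> real N" "real N \<le> ?s + 1"
    using s1 unfolding N_def by linarith+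
  \<comment> \<open>With exponent \<open>sqrt k\<close> and \<open>k\<close> increments of
    oscillation at most \<open>1 / k\<close>, the moment bound does not depend on
    \<open>k\<close>.\<close>
  have "?s\<^sup>2 * real k * (1 / real k)\<^sup>2 / 8 = 1 / 8" using k by (simp add: power2_eq_square)
  then have mgf: "avg (index_sets n k) (\<lambda>I. exp (?s * (f I - avg (index_sets n k) f))) \<le> exp (1 / 8)"
    if "\<And>K i j. K \<subseteq> {..<n} \<Longrightarrow> Suc (card K) = k \<Longrightarrow> i \<in> {..<n} - K \<Longrightarrow> j \<in> {..<n} - K \<Longrightarrow>
      \<bar>f (insert i K) - f (insert j K)\<bar> \<le> 1 / real k" for f
    using k_subsets_mgf_bound[of "{..<n}" k ?s "1 / real k" f] k s1 that
    unfolding index_sets_eq_k_subsets by simp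
  have upper: "avg (index_sets n k) (\<lambda>I. exp (?s * (?G I x - F x))) \<le> exp (1 / 8)" for x
    unfolding F_def by (rule mgf) (rule spectral_distr_swap[OF M])
  \<comment> \<open>The lower deviation is the upper deviation of the negated function.\<close>
  have lower: "avg (index_sets n k) (\<lambda>I. exp (?s * (F x - ?G I x))) \<le> exp (1 / 8)" for x
  proof -
    have "avg (index_sets n k) (\<lambda>I. exp (?s * (- ?G I x - avg (index_sets n k) (\<lambda>I. - ?G I x)))) \<le> exp (1 / 8)"
    proof (rule mgf)
      fix K i j assume "K \<subseteq> {..<n}" "Suc (card K) = k" "i \<in> {..<n} - K" "j \<in> {..<n} - K"
      then show "\<bar>- ?G (insert i K) x - - ?G (insert j K) x\<bar> \<le> 1 / real k"
        using spectral_distr_swap[OF M, of K k i j x] by linarith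
    qed
    then show ?thesis by (simp add: avg_minus F_def)
  qed
  have "avg (index_sets n k) (\<lambda>I. exp (?s * sup_norm (\<lambda>x. ?G I x - F x)))
      \<le> exp 1 * (2 * (real N + 1) * exp (1 / 8))"
  proof (rule avg_exp_sup_norm_le[OF index_sets_finite_nonempty[OF k(2)]])
    show "0 \<le> ?G I x \<and> ?G I x \<le> 1" if "I \<in> index_sets n k" for I x
      by (rule spectral_distr_bounds[OF principal_submatrix_carrier[OF M(1) that]])
    show "F x = avg (index_sets n k) (\<lambda>I. ?G I x)" for x by (simp only: F_def)
  qed (use s1 N(1) upper lower in \<open>auto simp: spectral_distr_mono finite_range_spectral_distr\<close>)
  \<comment> \<open>The constant 12 is \<open>2 * 3 * 2\<close>, from
    \<open>N + 1 \<le> sqrt k + 2 \<le> 3 * sqrt k\<close> and a crude bound on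
    \<open>exp (1 / 8)\<close>.\<close>
  also have "\<dots> \<le> exp 1 * (2 * (3 * ?s) * 2)"
  proof -
    have "exp (1 / 8) \<le> (2 :: real)" using exp_bound[of "1 / 8 :: real"] by (simp add: power2_eq_square)
    moreover have "real N + 1 \<le> 3 * ?s" using N s1 by linarith
    ultimately show ?thesis by (intro mult_left_mono mult_mono) auto
  qed
  finally show ?thesis by (simp add: mult_ac)
qed

text \<open>With \<open>h\<close> and \<open>D\<close> left open, this serves eigenvalues and
  singular values alike: bounds over uniform index sets pass to the image distribution of the
  submatrix.\<close>

lemma random_distr_deviation_bounds:
  fixes h :: "nat set \<Rightarrow> complex mat" and k n :: nat
  assumes k: "1 \<le> k" "k \<le> n"
    and p: "p = map_pmf h (pmf_of_set (index_sets n k))"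
    and mgf: "avg (index_sets n k) (\<lambda>I. exp (sqrt (real k) *
        sup_norm (\<lambda>x. D (h I) x - avg (index_sets n k) (\<lambda>I. D (h I) x))))
      \<le> 12 * exp 1 * sqrt (real k)"
  shows "let F = expected_distr p D
        in (\<forall>r :: real. r \<ge> 0 \<longrightarrow>
              measure_pmf.prob p {A. sup_norm (\<lambda>x. D A x - F x) \<ge> real k powr (-1/2) + r}
              \<le> 12 * sqrt (real k) * exp (- r * sqrt (real k / 8)))
         \<and> measure_pmf.expectation p (\<lambda>A. sup_norm (\<lambda>x. D A x - F x))
              \<le> (13 + sqrt 8 * ln (real k)) / sqrt (real k)"
proof -
  note W = index_sets_finite_nonempty[OF k(2)]
  have F: "expected_distr p D = (\<lambda>x. avg (index_sets n k) (\<lambda>I. D (h I) x))"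
    by (rule ext) (simp add: expected_distr_def p expectation_pmf_of_set_eq_avg[OF W])
  show ?thesis
    unfolding Let_def F unfolding p
    using deviation_bounds[OF W k(1) mgf] by (simp add: vimage_def)
qed

theorem theorem1:
  fixes k n :: nat
  assumes "1 \<le> k" and "k \<le> n"
  shows
    "(\<forall>M :: complex mat. M \<in> carrier_mat n n \<longrightarrow> hermitian M \<longrightarrow>
       (let p = random_principal_submatrix k M;
            F = expected_distr p spectral_distr
        in (\<forall>r :: real. r \<ge> 0 \<longrightarrow>
              measure_pmf.prob p
                {A. sup_norm (\<lambda>x. spectral_distr A x - F x) \<ge> real k powr (-1/2) + r}
              \<le> 12 * sqrt (real k) * exp (- r * sqrt (real k / 8)))
         \<and> measure_pmf.expectation p (\<lambda>A. sup_norm (\<lambda>x. spectral_distr A x - F x))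
              \<le> (13 + sqrt 8 * ln (real k)) / sqrt (real k)))
   \<and> (\<forall>M :: complex mat. M \<in> carrier_mat n n \<longrightarrow>
       (let p = random_row_submatrix k M;
            F = expected_distr p singular_distr
        in (\<forall>r :: real. r \<ge> 0 \<longrightarrow>
              measure_pmf.prob p
                {A. sup_norm (\<lambda>x. singular_distr A x - F x) \<ge> real k powr (-1/2) + r}
              \<le> 12 * sqrt (real k) * exp (- r * sqrt (real k / 8)))
         \<and> measure_pmf.expectation p (\<lambda>A. sup_norm (\<lambda>x. singular_distr A x - F x))
              \<le> (13 + sqrt 8 * ln (real k)) / sqrt (real k)))"
proof (intro conjI allI impI)
  fix M :: "complex mat" assume M: "M \<in> carrier_mat n n" "hermitian M"
  have p: "random_principal_submatrix k M
      = map_pmf (\<lambda>I. submatrix M I I) (pmf_of_set (index_sets n k))"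
    using M by (simp add: random_principal_submatrix_def)
  show "let p = random_principal_submatrix k M;
            F = expected_distr p spectral_distr
        in (\<forall>r :: real. r \<ge> 0 \<longrightarrow>
              measure_pmf.prob p
                {A. sup_norm (\<lambda>x. spectral_distr A x - F x) \<ge> real k powr (-1/2) + r}
              \<le> 12 * sqrt (real k) * exp (- r * sqrt (real k / 8)))
         \<and> measure_pmf.expectation p (\<lambda>A. sup_norm (\<lambda>x. spectral_distr A x - F x))
              \<le> (13 + sqrt 8 * ln (real k)) / sqrt (real k)"
    using random_distr_deviation_bounds[OF assms p avg_exp_sup_norm_spectral_distr[OF M assms]]
    unfolding Let_def .
next
  fix M :: "complex mat" assume M: "M \<in> carrier_mat n n"
  let ?H = "M * mat_adjoint M" and ?W = "index_sets n k"
  have H: "?H \<in> carrier_mat n n" by (rule mult_carrier_mat[OF M mat_adjoint_carrier[OF M]])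
  have p: "random_row_submatrix k M
      = map_pmf (\<lambda>I. submatrix M I {..<n}) (pmf_of_set ?W)"
    using M by (simp add: random_row_submatrix_def)
  let ?S = "\<lambda>I. spectral_distr (submatrix ?H I I)"
  \<comment> \<open>The same substitution \<open>sgn x * x\<^sup>2\<close> occurs in every sample
    and in the average, so the supremum norms of the two deviations agree.\<close>
  have S: "singular_distr (submatrix M I {..<n}) x = ?S I (sgn x * x\<^sup>2)" if "I \<in> ?W" for I x
    by (simp only: singular_distr_eq_spectral_distr row_submatrix_mult_adjoint[OF M that])
  then have F: "avg ?W (\<lambda>I. singular_distr (submatrix M I {..<n}) x)
      = avg ?W (\<lambda>I. ?S I (sgn x * x\<^sup>2))" for x
    by (intro avg_cong)
  have X: "sup_norm (\<lambda>x. singular_distr (submatrix M I {..<n}) x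
        - avg ?W (\<lambda>I. singular_distr (submatrix M I {..<n}) x))
      = sup_norm (\<lambda>x. ?S I x - avg ?W (\<lambda>I. ?S I x))" if "I \<in> ?W" for I
    using sup_norm_signed_square[of "\<lambda>y. ?S I y - avg ?W (\<lambda>I. ?S I y)"] by (simp only: S[OF that] F)
  have mgf: "avg ?W (\<lambda>I. exp (sqrt (real k) * sup_norm (\<lambda>x. singular_distr (submatrix M I {..<n}) x
        - avg ?W (\<lambda>I. singular_distr (submatrix M I {..<n}) x))))
      \<le> 12 * exp 1 * sqrt (real k)"
    using avg_exp_sup_norm_spectral_distr[OF H hermitian_mult_adjoint[OF M] assms]
    by (simp only: X cong: avg_cong)
  show "let p = random_row_submatrix k M;
            F = expected_distr p singular_distr
        in (\<forall>r :: real. r \<ge> 0 \<longrightarrow>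
              measure_pmf.prob p
                {A. sup_norm (\<lambda>x. singular_distr A x - F x) \<ge> real k powr (-1/2) + r}
              \<le> 12 * sqrt (real k) * exp (- r * sqrt (real k / 8)))
         \<and> measure_pmf.expectation p (\<lambda>A. sup_norm (\<lambda>x. singular_distr A x - F x))
              \<le> (13 + sqrt 8 * ln (real k)) / sqrt (real k)"
    using random_distr_deviation_bounds[OF assms p mgf] unfolding Let_def .
qed

end
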